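(* Let $S$ be a commutative local ring with involution $*$, and let $V$ be a free $S$-module of rank $2m$ ($m\ge1$) with a nondegenerate skew hermitian form $h:V\times V\to S$ such that $V$ has a symplectic basis. Let $\mathfrak i$ be a proper $*$-invariant ideal of $S$, $\tilde S=S/\mathfrak i$, $\tilde V=V/\mathfrak iV$, with the induced involution on $\tilde S$ and induced skew hermitian form $\tilde h$ on $\tilde V$. If $2\in S^\times$ then the reduction homomorphism $\pi:U(V)\to U(\tilde V)$, $X\mapsto\tilde X$, is surjective.
   Context: An involution of a commutative ring is a ring automorphism $*$ with $a^{**}=a$ (possibly trivial). A skew hermitian form $h$ is additive in each variable, $S$-linear in the second variable, and satisfies $h(u,v)^*=-h(v,u)$. A basis $u_1,v_1,\dots,u_m,v_m$ of $V$ is symplectic if $h(u_i,v_i)=1$ for all $i$, $h(u_i,u_j)=h(v_i,v_j)=0$ for all $i,j$, and $h(u_i,v_j)=0$ for $i\ne j$. $U(V)$ is the group of $S$-linear automorphisms of $V$ preserving $h$; similarly $U(\tilde V)$ for $(\tilde V,\tilde h)$ over $\tilde S$. Here $\tilde h(\tilde u,\tilde v)=h(u,v)+\mathfrak i$, where $\tilde u$ denotes the image of $u\in V$ in $\tilde V$, and $\tilde X$ is defined by $\tilde X\tilde u=\widetilde{Xu}$. *)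

theory Defs
  imports "HOL-Algebra.Module" "HOL-Algebra.QuotRing" "HOL-Algebra.Bij" "HOL-Algebra.Generated_Groups"
begin

section \<open>Local rings with involution and skew hermitian forms\<close>

locale local_cring = cring +
  assumes unique_maximal: "\<exists>!M. maximalideal M R"

definition ring_involution :: "('a, 'm) ring_scheme \<Rightarrow> ('a \<Rightarrow> 'a) \<Rightarrow> bool" where
  "ring_involution S star \<longleftrightarrow>
     star \<in> ring_iso S S \<and> (\<forall>a\<in>carrier S. star (star a) = a)"

definition skew_hermitian_form ::
  "('a, 'm) ring_scheme \<Rightarrow> ('a \<Rightarrow> 'a) \<Rightarrow> ('a, 'b, 'n) module_scheme \<Rightarrow> ('b \<Rightarrow> 'b \<Rightarrow> 'a) \<Rightarrow> bool" where
  "skew_hermitian_form S star V h \<longleftrightarrow>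
     (\<forall>u\<in>carrier V. \<forall>v\<in>carrier V. h u v \<in> carrier S) \<and>
     (\<forall>u\<in>carrier V. \<forall>v\<in>carrier V. \<forall>w\<in>carrier V.
        h (u \<oplus>\<^bsub>V\<^esub> v) w = h u w \<oplus>\<^bsub>S\<^esub> h v w \<and>
        h u (v \<oplus>\<^bsub>V\<^esub> w) = h u v \<oplus>\<^bsub>S\<^esub> h u w) \<and>
     (\<forall>a\<in>carrier S. \<forall>u\<in>carrier V. \<forall>v\<in>carrier V.
        h u (a \<odot>\<^bsub>V\<^esub> v) = a \<otimes>\<^bsub>S\<^esub> h u v) \<and>
     (\<forall>u\<in>carrier V. \<forall>v\<in>carrier V. star (h u v) = \<ominus>\<^bsub>S\<^esub> h v u)"

definition linear_functionals ::
  "('a, 'm) ring_scheme \<Rightarrow> ('a, 'b, 'n) module_scheme \<Rightarrow> ('b \<Rightarrow> 'a) set" where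
  "linear_functionals S V =
     {f \<in> carrier V \<rightarrow>\<^sub>E carrier S.
        (\<forall>u\<in>carrier V. \<forall>v\<in>carrier V. f (u \<oplus>\<^bsub>V\<^esub> v) = f u \<oplus>\<^bsub>S\<^esub> f v) \<and>
        (\<forall>a\<in>carrier S. \<forall>v\<in>carrier V. f (a \<odot>\<^bsub>V\<^esub> v) = a \<otimes>\<^bsub>S\<^esub> f v)}"

text \<open>Nondegeneracy is taken in the strong sense: \<open>u \<mapsto> h(u, -)\<close> identifies \<open>V\<close> with its
  dual module.\<close>

definition nondegenerate_form ::
  "('a, 'm) ring_scheme \<Rightarrow> ('a, 'b, 'n) module_scheme \<Rightarrow> ('b \<Rightarrow> 'b \<Rightarrow> 'a) \<Rightarrow> bool" where
  "nondegenerate_form S V h \<longleftrightarrow>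
     bij_betw (\<lambda>u. \<lambda>v\<in>carrier V. h u v) (carrier V) (linear_functionals S V)"

definition module_basis ::
  "('a, 'm) ring_scheme \<Rightarrow> ('a, 'b, 'n) module_scheme \<Rightarrow> 'i set \<Rightarrow> ('i \<Rightarrow> 'b) \<Rightarrow> bool" where
  "module_basis S V J e \<longleftrightarrow>
     finite J \<and> e \<in> J \<rightarrow> carrier V \<and>
     (\<forall>c \<in> J \<rightarrow> carrier S.
        finsum V (\<lambda>i. c i \<odot>\<^bsub>V\<^esub> e i) J = \<zero>\<^bsub>V\<^esub> \<longrightarrow> (\<forall>i\<in>J. c i = \<zero>\<^bsub>S\<^esub>)) \<and>
     (\<forall>x\<in>carrier V. \<exists>c \<in> J \<rightarrow> carrier S. x = finsum V (\<lambda>i. c i \<odot>\<^bsub>V\<^esub> e i) J)"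

definition free_module_of_rank ::
  "('a, 'm) ring_scheme \<Rightarrow> ('a, 'b, 'n) module_scheme \<Rightarrow> nat \<Rightarrow> bool" where
  "free_module_of_rank S V n \<longleftrightarrow> module S V \<and> (\<exists>e. module_basis S V {..<n} e)"

text \<open>The disjoint union of two copies of \<open>{..<m}\<close> indexes the family
  \<open>u 0, \<dots>, u (m - 1), v 0, \<dots>, v (m - 1)\<close>.\<close>

definition symplectic_basis ::
  "('a, 'm) ring_scheme \<Rightarrow> ('a, 'b, 'n) module_scheme \<Rightarrow> ('b \<Rightarrow> 'b \<Rightarrow> 'a) \<Rightarrow> nat
     \<Rightarrow> (nat \<Rightarrow> 'b) \<Rightarrow> (nat \<Rightarrow> 'b) \<Rightarrow> bool" where
  "symplectic_basis S V h m u v \<longleftrightarrow>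
     module_basis S V ({..<m} <+> {..<m}) (case_sum u v) \<and>
     (\<forall>i<m. h (u i) (v i) = \<one>\<^bsub>S\<^esub>) \<and>
     (\<forall>i<m. \<forall>j<m. h (u i) (u j) = \<zero>\<^bsub>S\<^esub> \<and> h (v i) (v j) = \<zero>\<^bsub>S\<^esub>) \<and>
     (\<forall>i<m. \<forall>j<m. i \<noteq> j \<longrightarrow> h (u i) (v j) = \<zero>\<^bsub>S\<^esub>)"

text \<open>Elements of \<open>Bij (carrier V)\<close> are \<^const>\<open>undefined\<close> outside \<open>carrier V\<close>, so
  equality in this group is equality of maps on \<open>V\<close>.\<close>

definition unitary_group ::
  "('a, 'm) ring_scheme \<Rightarrow> ('a, 'b, 'n) module_scheme \<Rightarrow> ('b \<Rightarrow> 'b \<Rightarrow> 'a) \<Rightarrow> ('b \<Rightarrow> 'b) monoid" where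
  "unitary_group S V h =
     (BijGroup (carrier V))
       \<lparr>carrier := {g \<in> Bij (carrier V).
          (\<forall>u\<in>carrier V. \<forall>v\<in>carrier V. g (u \<oplus>\<^bsub>V\<^esub> v) = g u \<oplus>\<^bsub>V\<^esub> g v) \<and>
          (\<forall>a\<in>carrier S. \<forall>v\<in>carrier V. g (a \<odot>\<^bsub>V\<^esub> v) = a \<odot>\<^bsub>V\<^esub> g v) \<and>
          (\<forall>u\<in>carrier V. \<forall>v\<in>carrier V. h (g u) (g v) = h u v)}\<rparr>"


section \<open>Reduction modulo an ideal\<close>

text \<open>\<open>ideal_smult V I\<close> is \<open>IV\<close>.\<close>

definition ideal_smult :: "('a, 'b, 'n) module_scheme \<Rightarrow> 'a set \<Rightarrow> 'b set" where
  "ideal_smult V I = generate (add_monoid V) {a \<odot>\<^bsub>V\<^esub> x | a x. a \<in> I \<and> x \<in> carrier V}"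

text \<open>\<open>V/IV\<close> as a module over \<open>S Quot I\<close>. As in \<^const>\<open>FactRing\<close>, operations on cosets are
  unions over all representatives; the lemmas at the end of this theory show that each union is
  the single coset given by any choice of representatives. The ring fields \<open>mult\<close> and \<open>one\<close>
  of a module record carry no meaning.\<close>

definition red_module :: "('a, 'b, 'n) module_scheme \<Rightarrow> 'a set \<Rightarrow> ('a set, 'b set) module" where
  "red_module V I =
     \<lparr>carrier = a_rcosets\<^bsub>V\<^esub> (ideal_smult V I), mult = undefined, one = undefined,
      zero = ideal_smult V I, add = set_add V,
      smult = (\<lambda>A B. \<Union>a\<in>A. \<Union>x\<in>B. ideal_smult V I +>\<^bsub>V\<^esub> (a \<odot>\<^bsub>V\<^esub> x))\<rparr>"

definition red_star :: "('a, 'm) ring_scheme \<Rightarrow> 'a set \<Rightarrow> ('a \<Rightarrow> 'a) \<Rightarrow> 'a set \<Rightarrow> 'a set" where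
  "red_star S I star A = (\<Union>a\<in>A. I +>\<^bsub>S\<^esub> star a)"

definition red_form ::
  "('a, 'm) ring_scheme \<Rightarrow> 'a set \<Rightarrow> ('b \<Rightarrow> 'b \<Rightarrow> 'a) \<Rightarrow> 'b set \<Rightarrow> 'b set \<Rightarrow> 'a set" where
  "red_form S I h A B = (\<Union>u\<in>A. \<Union>v\<in>B. I +>\<^bsub>S\<^esub> h u v)"

definition red_map ::
  "('a, 'b, 'n) module_scheme \<Rightarrow> 'a set \<Rightarrow> ('b \<Rightarrow> 'b) \<Rightarrow> 'b set \<Rightarrow> 'b set" where
  "red_map V I g = (\<lambda>A\<in>carrier (red_module V I). \<Union>u\<in>A. ideal_smult V I +>\<^bsub>V\<^esub> g u)"

subsection \<open>The reductions are well defined\<close>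

lemma UN_eq_const: "a \<in> A \<Longrightarrow> (\<And>b. b \<in> A \<Longrightarrow> F b = C) \<Longrightarrow> (\<Union>b\<in>A. F b) = C"
  by blast

context
  fixes S :: "('a, 'm) ring_scheme" and V :: "('a, 'b, 'n) module_scheme" and I :: "'a set"
  assumes mod: "module S V" and idl: "ideal I S"
begin

interpretation module S V by (rule mod)
interpretation J: ideal I S by (rule idl)
interpretation J: abelian_subgroup I S
  by (rule abelian_subgroupI3) (auto intro: J.additive_subgroup_axioms R.abelian_group_axioms)

lemma ideal_smult_gens_subset: "{a \<odot>\<^bsub>V\<^esub> x | a x. a \<in> I \<and> x \<in> carrier V} \<subseteq> carrier (add_monoid V)"
  using J.Icarr by auto

lemma ideal_smult_gen: "a \<in> I \<Longrightarrow> x \<in> carrier V \<Longrightarrow> a \<odot>\<^bsub>V\<^esub> x \<in> ideal_smult V I"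
  unfolding ideal_smult_def by (rule generate.incl) auto

lemma ideal_smult_subgroup: "subgroup (ideal_smult V I) (add_monoid V)"
  unfolding ideal_smult_def
  by (rule group.generate_is_subgroup[OF M.a_group ideal_smult_gens_subset])

lemma ideal_smult_abelian_subgroup: "abelian_subgroup (ideal_smult V I) V"
  by (rule abelian_subgroupI3)
    (auto intro: additive_subgroupI ideal_smult_subgroup M.abelian_group_axioms)

interpretation N: abelian_subgroup "ideal_smult V I" V by (rule ideal_smult_abelian_subgroup)

lemma ideal_smult_induct [consumes 1, case_names zero smult plus]:
  assumes "x \<in> ideal_smult V I"
    and "P \<zero>\<^bsub>V\<^esub>"
    and "\<And>a v. a \<in> I \<Longrightarrow> v \<in> carrier V \<Longrightarrow> P (a \<odot>\<^bsub>V\<^esub> v)"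
    and "\<And>v w. v \<in> ideal_smult V I \<Longrightarrow> w \<in> ideal_smult V I \<Longrightarrow> P v \<Longrightarrow> P w \<Longrightarrow> P (v \<oplus>\<^bsub>V\<^esub> w)"
  shows "P x"
proof -
  from assms(1) have "x \<in> generate (add_monoid V) {a \<odot>\<^bsub>V\<^esub> x | a x. a \<in> I \<and> x \<in> carrier V}"
    by (simp add: ideal_smult_def)
  then show ?thesis
  proof (induction rule: generate.induct)
    case one
    then show ?case using assms(2) by simp
  next
    case (incl h)
    then show ?case using assms(3) by auto
  next
    case (inv h)
    then obtain a v where av: "a \<in> I" "v \<in> carrier V" "h = a \<odot>\<^bsub>V\<^esub> v" by auto
    then have "inv\<^bsub>add_monoid V\<^esub> h = \<ominus>\<^bsub>V\<^esub> (a \<odot>\<^bsub>V\<^esub> v)" by (simp add: a_inv_def)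
    also have "\<dots> = (\<ominus>\<^bsub>S\<^esub> a) \<odot>\<^bsub>V\<^esub> v" using av J.Icarr by (simp add: smult_l_minus)
    finally show ?case using assms(3)[of "\<ominus>\<^bsub>S\<^esub> a" v] av by simp
  next
    case (eng h1 h2)
    then show ?case using assms(4)[of h1 h2] by (simp add: ideal_smult_def)
  qed
qed

lemma ideal_smult_smult:
  assumes "a \<in> carrier S" and "x \<in> ideal_smult V I"
  shows "a \<odot>\<^bsub>V\<^esub> x \<in> ideal_smult V I"
  using assms(2,1)
proof (induction x rule: ideal_smult_induct)
  case zero
  then show ?case by simp
next
  case (smult b v)
  then have "a \<odot>\<^bsub>V\<^esub> (b \<odot>\<^bsub>V\<^esub> v) = (a \<otimes>\<^bsub>S\<^esub> b) \<odot>\<^bsub>V\<^esub> v"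
    using J.Icarr by (simp add: smult_assoc1)
  with smult show ?case using ideal_smult_gen[of "a \<otimes>\<^bsub>S\<^esub> b" v] by (simp add: J.I_l_closed)
next
  case (plus v w)
  then show ?case by (simp add: smult_r_distr)
qed

lemma red_module_carrierE:
  assumes "A \<in> carrier (red_module V I)"
  obtains u where "u \<in> carrier V" "A = ideal_smult V I +>\<^bsub>V\<^esub> u"
  using assms by (auto simp: red_module_def A_RCOSETS_def')

lemma red_module_carrierI: "u \<in> carrier V \<Longrightarrow> ideal_smult V I +>\<^bsub>V\<^esub> u \<in> carrier (red_module V I)"
  by (auto simp: red_module_def A_RCOSETS_def')

lemma red_module_add:
  "u \<in> carrier V \<Longrightarrow> v \<in> carrier V \<Longrightarrow>
     (ideal_smult V I +>\<^bsub>V\<^esub> u) \<oplus>\<^bsub>red_module V I\<^esub> (ideal_smult V I +>\<^bsub>V\<^esub> v)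
       = ideal_smult V I +>\<^bsub>V\<^esub> (u \<oplus>\<^bsub>V\<^esub> v)"
  by (simp add: red_module_def N.a_rcos_sum)

lemma coset_memE:
  assumes "x \<in> ideal_smult V I +>\<^bsub>V\<^esub> u"
  obtains y where "y \<in> ideal_smult V I" "x = y \<oplus>\<^bsub>V\<^esub> u"
  using assms by (auto simp: a_r_coset_def')

lemma ideal_coset_memE:
  assumes "x \<in> I +>\<^bsub>S\<^esub> a"
  obtains b where "b \<in> I" "x = b \<oplus>\<^bsub>S\<^esub> a"
  using assms by (auto simp: a_r_coset_def')

lemma red_module_smult:
  assumes a: "a \<in> carrier S" and u: "u \<in> carrier V"
  shows "(I +>\<^bsub>S\<^esub> a) \<odot>\<^bsub>red_module V I\<^esub> (ideal_smult V I +>\<^bsub>V\<^esub> u)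
       = ideal_smult V I +>\<^bsub>V\<^esub> (a \<odot>\<^bsub>V\<^esub> u)"
proof -
  have "ideal_smult V I +>\<^bsub>V\<^esub> (b \<odot>\<^bsub>V\<^esub> x) = ideal_smult V I +>\<^bsub>V\<^esub> (a \<odot>\<^bsub>V\<^esub> u)"
    if b: "b \<in> I +>\<^bsub>S\<^esub> a" and x: "x \<in> ideal_smult V I +>\<^bsub>V\<^esub> u" for b x
  proof -
    obtain c where c: "c \<in> I" "b = c \<oplus>\<^bsub>S\<^esub> a" using b by (rule ideal_coset_memE)
    obtain y where y: "y \<in> ideal_smult V I" "x = y \<oplus>\<^bsub>V\<^esub> u" using x by (rule coset_memE)
    note cs = J.Icarr[OF c(1)] N.a_Hcarr[OF y(1)] a u
    have "b \<odot>\<^bsub>V\<^esub> x = (c \<odot>\<^bsub>V\<^esub> (y \<oplus>\<^bsub>V\<^esub> u) \<oplus>\<^bsub>V\<^esub> a \<odot>\<^bsub>V\<^esub> y) \<oplus>\<^bsub>V\<^esub> a \<odot>\<^bsub>V\<^esub> u"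
      using cs c y by (simp add: smult_l_distr smult_r_distr M.a_ac)
    moreover have "c \<odot>\<^bsub>V\<^esub> (y \<oplus>\<^bsub>V\<^esub> u) \<oplus>\<^bsub>V\<^esub> a \<odot>\<^bsub>V\<^esub> y \<in> ideal_smult V I"
      using cs c y by (intro N.a_closed ideal_smult_gen ideal_smult_smult) auto
    ultimately have "b \<odot>\<^bsub>V\<^esub> x \<in> ideal_smult V I +>\<^bsub>V\<^esub> (a \<odot>\<^bsub>V\<^esub> u)"
      by (auto simp: a_r_coset_def')
    then show ?thesis by (rule N.a_repr_independence'[symmetric]) (use cs in simp)
  qed
  moreover have "a \<in> I +>\<^bsub>S\<^esub> a" "u \<in> ideal_smult V I +>\<^bsub>V\<^esub> u"
    using a u J.a_rcos_self N.a_rcos_self by auto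
  ultimately have "(\<Union>b\<in>I +>\<^bsub>S\<^esub> a. \<Union>x\<in>ideal_smult V I +>\<^bsub>V\<^esub> u. ideal_smult V I +>\<^bsub>V\<^esub> (b \<odot>\<^bsub>V\<^esub> x))
      = ideal_smult V I +>\<^bsub>V\<^esub> (a \<odot>\<^bsub>V\<^esub> u)"
    by (intro UN_eq_const)
  then show ?thesis by (simp add: red_module_def)
qed

lemma quot_carrierE:
  assumes "A \<in> carrier (S Quot I)"
  obtains a where "a \<in> carrier S" "A = I +>\<^bsub>S\<^esub> a"
  using assms by (auto simp: FactRing_def A_RCOSETS_def')

lemma quot_carrierI: "a \<in> carrier S \<Longrightarrow> I +>\<^bsub>S\<^esub> a \<in> carrier (S Quot I)"
  by (auto simp: FactRing_def A_RCOSETS_def')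

lemma quot_add: "a \<in> carrier S \<Longrightarrow> b \<in> carrier S \<Longrightarrow>
    (I +>\<^bsub>S\<^esub> a) \<oplus>\<^bsub>S Quot I\<^esub> (I +>\<^bsub>S\<^esub> b) = I +>\<^bsub>S\<^esub> (a \<oplus>\<^bsub>S\<^esub> b)"
  by (simp add: FactRing_def J.a_rcos_sum)

lemma quot_mult: "a \<in> carrier S \<Longrightarrow> b \<in> carrier S \<Longrightarrow>
    (I +>\<^bsub>S\<^esub> a) \<otimes>\<^bsub>S Quot I\<^esub> (I +>\<^bsub>S\<^esub> b) = I +>\<^bsub>S\<^esub> (a \<otimes>\<^bsub>S\<^esub> b)"
  by (simp add: FactRing_def J.rcoset_mult_add)

lemma quot_one: "\<one>\<^bsub>S Quot I\<^esub> = I +>\<^bsub>S\<^esub> \<one>\<^bsub>S\<^esub>"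
  by (simp add: FactRing_def)

lemma red_module_is_module: "module (S Quot I) (red_module V I)"
proof (rule moduleI)
  show "cring (S Quot I)" by (rule J.quotient_is_cring[OF R.is_cring])
  have z: "\<zero>\<^bsub>red_module V I\<^esub> = ideal_smult V I +>\<^bsub>V\<^esub> \<zero>\<^bsub>V\<^esub>"
    using N.a_subset by (simp add: red_module_def M.a_coset_add_zero)
  show "abelian_group (red_module V I)"
  proof (rule abelian_groupI)
    fix A assume "A \<in> carrier (red_module V I)"
    then obtain u where u: "u \<in> carrier V" "A = ideal_smult V I +>\<^bsub>V\<^esub> u"
      by (rule red_module_carrierE)
    then show "\<exists>B\<in>carrier (red_module V I). B \<oplus>\<^bsub>red_module V I\<^esub> A = \<zero>\<^bsub>red_module V I\<^esub>"
      by (intro bexI[of _ "ideal_smult V I +>\<^bsub>V\<^esub> (\<ominus>\<^bsub>V\<^esub> u)"])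
        (simp_all add: red_module_add red_module_carrierI z M.l_neg)
  qed (auto elim!: red_module_carrierE simp: z red_module_add red_module_carrierI M.a_ac)
qed (auto elim!: quot_carrierE red_module_carrierE
      simp: red_module_smult red_module_add quot_add quot_mult quot_one smult_l_distr smult_r_distr
        smult_assoc1 red_module_carrierI)

lemma red_form_coset:
  assumes skew: "skew_hermitian_form S star V h" and inv: "ring_involution S star"
    and starI: "star ` I \<subseteq> I" and u: "u \<in> carrier V" and v: "v \<in> carrier V"
  shows "red_form S I h (ideal_smult V I +>\<^bsub>V\<^esub> u) (ideal_smult V I +>\<^bsub>V\<^esub> v) = I +>\<^bsub>S\<^esub> h u v"
proof -
  have cl: "\<And>u v. u \<in> carrier V \<Longrightarrow> v \<in> carrier V \<Longrightarrow> h u v \<in> carrier S"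
    and addl: "\<And>u v w. u \<in> carrier V \<Longrightarrow> v \<in> carrier V \<Longrightarrow> w \<in> carrier V \<Longrightarrow>
      h (u \<oplus>\<^bsub>V\<^esub> v) w = h u w \<oplus>\<^bsub>S\<^esub> h v w"
    and addr: "\<And>u v w. u \<in> carrier V \<Longrightarrow> v \<in> carrier V \<Longrightarrow> w \<in> carrier V \<Longrightarrow>
      h u (v \<oplus>\<^bsub>V\<^esub> w) = h u v \<oplus>\<^bsub>S\<^esub> h u w"
    and lin: "\<And>a u v. a \<in> carrier S \<Longrightarrow> u \<in> carrier V \<Longrightarrow> v \<in> carrier V \<Longrightarrow>
      h u (a \<odot>\<^bsub>V\<^esub> v) = a \<otimes>\<^bsub>S\<^esub> h u v"
    and sk: "\<And>u v. u \<in> carrier V \<Longrightarrow> v \<in> carrier V \<Longrightarrow> star (h u v) = \<ominus>\<^bsub>S\<^esub> h v u"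
    using skew unfolding skew_hermitian_form_def by blast+
  have r: "h x y \<in> I" if x: "x \<in> carrier V" and y: "y \<in> ideal_smult V I" for x y
    using y
  proof (induction y rule: ideal_smult_induct)
    case zero
    have "h x (\<zero>\<^bsub>S\<^esub> \<odot>\<^bsub>V\<^esub> \<zero>\<^bsub>V\<^esub>) = \<zero>\<^bsub>S\<^esub> \<otimes>\<^bsub>S\<^esub> h x \<zero>\<^bsub>V\<^esub>" by (rule lin) (use x in auto)
    then show ?case using x cl by simp
  next
    case (smult a w)
    then show ?case using x cl lin J.I_r_closed J.Icarr by simp
  next
    case (plus w z)
    then show ?case using x addr by simp
  qed
  have l: "h y x \<in> I" if x: "x \<in> carrier V" and y: "y \<in> ideal_smult V I" for x y
  proof -
    have yc: "y \<in> carrier V" using y by simp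
    have "\<ominus>\<^bsub>S\<^esub> h y x \<in> I" using r[OF x y] sk[OF x yc] starI by (metis image_subset_iff)
    then have "\<ominus>\<^bsub>S\<^esub> (\<ominus>\<^bsub>S\<^esub> h y x) \<in> I" by simp
    then show ?thesis using cl[OF yc x] by simp
  qed
  have "I +>\<^bsub>S\<^esub> h x y = I +>\<^bsub>S\<^esub> h u v"
    if x: "x \<in> ideal_smult V I +>\<^bsub>V\<^esub> u" and y: "y \<in> ideal_smult V I +>\<^bsub>V\<^esub> v" for x y
  proof -
    obtain x' where x': "x' \<in> ideal_smult V I" "x = x' \<oplus>\<^bsub>V\<^esub> u" using x by (rule coset_memE)
    obtain y' where y': "y' \<in> ideal_smult V I" "y = y' \<oplus>\<^bsub>V\<^esub> v" using y by (rule coset_memE)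
    note cs = N.a_Hcarr[OF x'(1)] N.a_Hcarr[OF y'(1)] u v
    have "h x y = (h x' (y' \<oplus>\<^bsub>V\<^esub> v) \<oplus>\<^bsub>S\<^esub> h u y') \<oplus>\<^bsub>S\<^esub> h u v"
      using cs by (simp add: x' y' addl addr cl R.a_ac)
    moreover have "h x' (y' \<oplus>\<^bsub>V\<^esub> v) \<oplus>\<^bsub>S\<^esub> h u y' \<in> I"
      using cs x' y' l r by (intro J.a_closed) auto
    ultimately have "h x y \<in> I +>\<^bsub>S\<^esub> h u v" by (auto simp: a_r_coset_def')
    then show ?thesis by (rule J.a_repr_independence'[symmetric]) (use cs cl in simp)
  qed
  moreover have "u \<in> ideal_smult V I +>\<^bsub>V\<^esub> u" "v \<in> ideal_smult V I +>\<^bsub>V\<^esub> v"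
    using u v N.a_rcos_self by auto
  ultimately show ?thesis
    unfolding red_form_def by (intro UN_eq_const)
qed

lemma red_star_coset:
  assumes inv: "ring_involution S star" and starI: "star ` I \<subseteq> I" and a: "a \<in> carrier S"
  shows "red_star S I star (I +>\<^bsub>S\<^esub> a) = I +>\<^bsub>S\<^esub> star a"
proof -
  have hom: "star \<in> ring_hom S S" using inv by (simp add: ring_involution_def ring_iso_def)
  have "I +>\<^bsub>S\<^esub> star b = I +>\<^bsub>S\<^esub> star a" if b: "b \<in> I +>\<^bsub>S\<^esub> a" for b
  proof -
    obtain c where c: "c \<in> I" "b = c \<oplus>\<^bsub>S\<^esub> a" using b by (rule ideal_coset_memE)
    have "star b = star c \<oplus>\<^bsub>S\<^esub> star a" using c a J.Icarr ring_hom_add[OF hom] by simp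
    then have "star b \<in> I +>\<^bsub>S\<^esub> star a" using c starI by (auto simp: a_r_coset_def')
    then show ?thesis by (rule J.a_repr_independence'[symmetric]) (use a ring_hom_closed[OF hom] in simp)
  qed
  moreover have "a \<in> I +>\<^bsub>S\<^esub> a" using a J.a_rcos_self by auto
  ultimately show ?thesis
    unfolding red_star_def by (intro UN_eq_const)
qed

lemma red_star_involution:
  assumes inv: "ring_involution S star" and starI: "star ` I \<subseteq> I"
  shows "ring_involution (S Quot I) (red_star S I star)"
proof -
  have hom: "star \<in> ring_hom S S" and ss: "\<And>a. a \<in> carrier S \<Longrightarrow> star (star a) = a"
    using inv by (simp_all add: ring_involution_def ring_iso_def)
  note st = red_star_coset[OF inv starI] ring_hom_closed[OF hom]
  have two: "red_star S I star (red_star S I star A) = A" if "A \<in> carrier (S Quot I)" for A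
    using that by (auto elim!: quot_carrierE simp: st ss)
  have into: "red_star S I star A \<in> carrier (S Quot I)" if "A \<in> carrier (S Quot I)" for A
    using that by (auto elim!: quot_carrierE simp: st quot_carrierI)
  have "red_star S I star \<in> ring_hom (S Quot I) (S Quot I)"
    by (rule ring_hom_memI)
      (auto elim!: quot_carrierE simp: st quot_carrierI quot_add quot_mult quot_one
        ring_hom_add[OF hom] ring_hom_mult[OF hom] ring_hom_one[OF hom])
  moreover have "bij_betw (red_star S I star) (carrier (S Quot I)) (carrier (S Quot I))"
    by (rule bij_betw_byWitness[where f' = "red_star S I star"]) (use two into in auto)
  ultimately show ?thesis using two by (simp add: ring_involution_def ring_iso_def)
qed

lemma red_form_skew_hermitian:
  assumes skew: "skew_hermitian_form S star V h" and inv: "ring_involution S star"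
    and starI: "star ` I \<subseteq> I"
  shows "skew_hermitian_form (S Quot I) (red_star S I star) (red_module V I) (red_form S I h)"
proof -
  have cl: "\<And>u v. u \<in> carrier V \<Longrightarrow> v \<in> carrier V \<Longrightarrow> h u v \<in> carrier S"
    using skew unfolding skew_hermitian_form_def by blast
  have minus: "I +>\<^bsub>S\<^esub> (\<ominus>\<^bsub>S\<^esub> a) = \<ominus>\<^bsub>S Quot I\<^esub> (I +>\<^bsub>S\<^esub> a)" if "a \<in> carrier S" for a
  proof -
    interpret h: ring_hom_ring S "S Quot I" "(+>\<^bsub>S\<^esub>) I" by (rule J.rcos_ring_hom_ring)
    show ?thesis using that by simp
  qed
  note f = red_form_coset[OF skew inv starI] red_star_coset[OF inv starI]
  show ?thesis
    using skew unfolding skew_hermitian_form_def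
    by (auto elim!: quot_carrierE red_module_carrierE
        simp: f cl quot_carrierI red_module_add red_module_smult quot_add quot_mult minus)
qed

lemma red_map_coset:
  assumes g: "g \<in> carrier (unitary_group S V h)" and u: "u \<in> carrier V"
  shows "red_map V I g (ideal_smult V I +>\<^bsub>V\<^esub> u) = ideal_smult V I +>\<^bsub>V\<^esub> g u"
proof -
  have cl: "\<And>v. v \<in> carrier V \<Longrightarrow> g v \<in> carrier V"
    and add: "\<And>v w. v \<in> carrier V \<Longrightarrow> w \<in> carrier V \<Longrightarrow> g (v \<oplus>\<^bsub>V\<^esub> w) = g v \<oplus>\<^bsub>V\<^esub> g w"
    and lin: "\<And>a v. a \<in> carrier S \<Longrightarrow> v \<in> carrier V \<Longrightarrow> g (a \<odot>\<^bsub>V\<^esub> v) = a \<odot>\<^bsub>V\<^esub> g v"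
    using g by (auto simp: unitary_group_def Bij_def dest: bij_betwE)
  have N: "g y \<in> ideal_smult V I" if "y \<in> ideal_smult V I" for y
    using that
  proof (induction y rule: ideal_smult_induct)
    case zero
    have "g (\<zero>\<^bsub>S\<^esub> \<odot>\<^bsub>V\<^esub> \<zero>\<^bsub>V\<^esub>) = \<zero>\<^bsub>S\<^esub> \<odot>\<^bsub>V\<^esub> g \<zero>\<^bsub>V\<^esub>"
      by (rule lin) auto
    then show ?case using cl by simp
  next
    case (smult a w)
    then show ?case using cl lin ideal_smult_gen J.Icarr by simp
  next
    case (plus w z)
    then show ?case using add by simp
  qed
  have "ideal_smult V I +>\<^bsub>V\<^esub> g x = ideal_smult V I +>\<^bsub>V\<^esub> g u"
    if x: "x \<in> ideal_smult V I +>\<^bsub>V\<^esub> u" for x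
  proof -
    obtain y where y: "y \<in> ideal_smult V I" "x = y \<oplus>\<^bsub>V\<^esub> u" using x by (rule coset_memE)
    then have "g x = g y \<oplus>\<^bsub>V\<^esub> g u" using u add by simp
    then have "g x \<in> ideal_smult V I +>\<^bsub>V\<^esub> g u" using N y by (auto simp: a_r_coset_def')
    then show ?thesis by (rule N.a_repr_independence'[symmetric]) (use u cl in simp)
  qed
  moreover have "u \<in> ideal_smult V I +>\<^bsub>V\<^esub> u" using u N.a_rcos_self by auto
  ultimately have "(\<Union>x\<in>ideal_smult V I +>\<^bsub>V\<^esub> u. ideal_smult V I +>\<^bsub>V\<^esub> g x) = ideal_smult V I +>\<^bsub>V\<^esub> g u"
    by (intro UN_eq_const)
  then show ?thesis using red_module_carrierI[OF u] by (simp add: red_map_def)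
qed

end

end

theory Submission
  imports Defs "HOL-Algebra.Divisibility"
begin

text \<open>
  Lifting an isometry of \<open>V/IV\<close> entry by entry would mean solving many quadratic equations over
  \<open>S\<close> at once. The proof lifts generators instead. They are the quasi-reflections
  \<open>z \<mapsto> z + a h(w, z) w\<close>, where \<open>a\<close> is a unit; such a map preserves \<open>h\<close> as soon as
  \<open>a = a* + a* a h(w, w)\<close>, and in terms of \<open>c = 1/a\<close> this is the additive equation
  \<open>c - c* + h(w, w) = 0\<close>.

  They generate the unitary group of \<open>V/IV\<close>
  (\<open>unitary_group_generated_by_quasi_reflections\<close>). If \<open>x\<close>, \<open>y\<close> are isotropic and \<open>h(y, x)\<close> is a unit,
  the quasi-reflection along \<open>x - y\<close> with \<open>c = h(y, x)\<close> carries \<open>x\<close> to \<open>y\<close> and fixes every vector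
  that pairs equally with \<open>x\<close> and \<open>y\<close>. If \<open>h(y, x)\<close> is not a unit, one goes through an isotropic \<open>z\<close> that
  pairs to a unit with both; over a local ring \<open>z\<close> can be taken to be a basis vector or a sum of two of
  them, because a nonunit plus a unit is a unit. Given a unitary \<open>g\<close> that fixes the pairs
  \<open>u\<^sub>i\<close>, \<open>v\<^sub>i\<close> with \<open>i < k\<close>, a few quasi-reflections fixing these pairs carry \<open>g u\<^sub>k\<close> back to \<open>u\<^sub>k\<close>
  and then the image of \<open>g v\<^sub>k\<close> back to \<open>v\<^sub>k\<close>, and induction on \<open>k\<close> finishes.

  Each quasi-reflection lifts (\<open>lift_reflection_scalar\<close>). Lift \<open>w\<close> and \<open>c\<close> arbitrarily. Then
  \<open>e = c - c* + h(w, w)\<close> lies in \<open>I\<close> and \<open>e* = -e\<close>, so \<open>c - e/2\<close> solves the equation exactly and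
  has the same class modulo \<open>I\<close>; this is where \<open>2\<close> has to be invertible. The new scalar is a unit
  because \<open>S\<close> is local and \<open>I\<close> is proper (\<open>unit_mod_ideal_imp_unit\<close>).

  Reduction is a group homomorphism, so its image is a subgroup; as it contains the generators, it is
  everything.
\<close>

section \<open>Units in local rings\<close>

text \<open>Zorn's lemma applies to the ideals that contain \<open>J\<close> and omit \<open>\<one>\<close>, since omitting \<open>\<one>\<close> is
  inherited by unions of chains.\<close>

lemma (in cring) exists_maximalideal_containing:
  assumes J: "ideal J R" and proper: "J \<noteq> carrier R"
  shows "\<exists>M. maximalideal M R \<and> J \<subseteq> M"
proof -
  define A where "A = {K. ideal K R \<and> J \<subseteq> K \<and> \<one> \<notin> K}"
  have "\<one> \<notin> J" using proper ideal.one_imp_carrier[OF J] by blast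
  then have ne: "A \<noteq> {}" using J by (auto simp: A_def)
  have chain: "\<Union>C \<in> A" if C: "C \<noteq> {}" "subset.chain A C" for C
  proof -
    have id: "\<And>K. K \<in> C \<Longrightarrow> ideal K R" and JK: "\<And>K. K \<in> C \<Longrightarrow> J \<subseteq> K"
      and one: "\<And>K. K \<in> C \<Longrightarrow> \<one> \<notin> K"
      and tot: "\<And>K L. K \<in> C \<Longrightarrow> L \<in> C \<Longrightarrow> K \<subseteq> L \<or> L \<subseteq> K"
      using C(2) by (auto simp: subset.chain_def A_def)
    obtain K0 where K0: "K0 \<in> C" using C(1) by blast
    have "ideal (\<Union>C) R"
    proof (intro idealI ring_axioms subgroup.intro)
      show "\<Union>C \<subseteq> carrier (add_monoid R)" using id by (auto dest: ideal.Icarr)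
    next
      fix x y assume "x \<in> \<Union>C" "y \<in> \<Union>C"
      then obtain K L where KL: "K \<in> C" "L \<in> C" "x \<in> K" "y \<in> L" by blast
      with tot obtain N where N: "N \<in> C" "x \<in> N" "y \<in> N" by blast
      then interpret N: ideal N R using id by blast
      show "x \<otimes>\<^bsub>add_monoid R\<^esub> y \<in> \<Union>C" using N N.a_closed by auto
    next
      interpret K0: ideal K0 R using id K0 by blast
      show "\<one>\<^bsub>add_monoid R\<^esub> \<in> \<Union>C" by (rule UnionI[OF K0]) simp
    next
      fix x assume "x \<in> \<Union>C"
      then obtain K where K: "K \<in> C" "x \<in> K" by blast
      then interpret K: ideal K R using id by blast
      show "inv\<^bsub>add_monoid R\<^esub> x \<in> \<Union>C" using K K.a_inv_closed by (auto simp: a_inv_def)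
    qed (use id in \<open>blast intro: ideal.I_l_closed ideal.I_r_closed\<close>)+
    then show ?thesis using JK one K0 by (auto simp: A_def)
  qed
  obtain M where M: "M \<in> A" and max: "\<And>K. K \<in> A \<Longrightarrow> M \<subseteq> K \<Longrightarrow> K = M"
    using subset_Zorn_nonempty[OF ne chain] by blast
  have "maximalideal M R"
  proof (rule maximalidealI)
    show "ideal M R" using M by (simp add: A_def)
    show "carrier R \<noteq> M" using M by (auto simp: A_def)
    show "K = M \<or> K = carrier R" if "ideal K R" "M \<subseteq> K" "K \<subseteq> carrier R" for K
    proof (cases "\<one> \<in> K")
      case True
      then show ?thesis using ideal.one_imp_carrier[OF that(1)] by blast
    next
      case False
      then have "K \<in> A" using that M by (auto simp: A_def)
      then show ?thesis using max that by blast
    qed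
  qed
  then show ?thesis using M by (auto simp: A_def)
qed

lemma (in cring) nonunit_in_maximalideal:
  assumes a: "a \<in> carrier R" and nu: "a \<notin> Units R"
  shows "\<exists>M. maximalideal M R \<and> a \<in> M"
proof -
  have "\<one> \<notin> PIdl a"
  proof
    assume "\<one> \<in> PIdl a"
    then obtain b where "b \<in> carrier R" "\<one> = b \<otimes> a" by (auto simp: cgenideal_def)
    then show False using a nu by (metis Units_one_closed m_comm unit_factor)
  qed
  then have "PIdl a \<noteq> carrier R" by auto
  then obtain M where "maximalideal M R" "PIdl a \<subseteq> M"
    using exists_maximalideal_containing[OF cgenideal_ideal[OF a]] by blast
  then show ?thesis using cgenideal_self[OF a] by blast
qed

lemma (in ideal) unit_imp_carrier:
  assumes "a \<in> Units R" and "a \<in> I"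
  shows "I = carrier R"
  using I_l_closed[OF assms(2), of "inv a"] assms(1) one_imp_carrier by simp

text \<open>Two nonunits lie in maximal ideals, and these coincide, so their sum lies there too.\<close>

lemma (in local_cring) sum_unit_imp_unit:
  assumes a: "a \<in> carrier R" and b: "b \<in> carrier R" and ab: "a \<oplus> b \<in> Units R"
  shows "a \<in> Units R \<or> b \<in> Units R"
proof (rule ccontr)
  assume "\<not> ?thesis"
  then obtain M N where "maximalideal M R" "a \<in> M" "maximalideal N R" "b \<in> N"
    using nonunit_in_maximalideal a b by blast
  then have M: "maximalideal M R" "a \<in> M" "b \<in> M" using unique_maximal by auto
  interpret M: maximalideal M R by (rule M(1))
  have "a \<oplus> b \<in> M" using M by simp
  then show False using M.unit_imp_carrier[OF ab] M.I_notcarr by simp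
qed

text \<open>An inverse modulo \<open>I\<close> gives \<open>1 = i + a b\<close> with \<open>i \<in> I\<close>. Since \<open>i\<close> is no unit, \<open>a b\<close> is one.
  Hence units, and with them the defining property of a local ring, pass between \<open>R\<close> and \<open>R/I\<close>.\<close>

lemma (in local_cring) unit_mod_ideal_imp_unit:
  assumes I: "ideal I R" "I \<noteq> carrier R" and a: "a \<in> carrier R"
    and unit: "I +> a \<in> Units (R Quot I)"
  shows "a \<in> Units R"
proof -
  interpret I: ideal I R by (rule I(1))
  obtain B where B: "B \<in> carrier (R Quot I)" "(I +> a) \<otimes>\<^bsub>R Quot I\<^esub> B = \<one>\<^bsub>R Quot I\<^esub>"
    using unit by (auto simp: Units_def)
  then obtain b where b: "b \<in> carrier R" "B = I +> b"
    by (auto simp: FactRing_def A_RCOSETS_def')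
  have "I +> \<one> = I +> (a \<otimes> b)"
    using B a b by (simp add: FactRing_def I.rcoset_mult_add)
  then have "\<one> \<in> I +> (a \<otimes> b)" using I.a_rcos_self by blast
  then obtain i where i: "i \<in> I" "\<one> = i \<oplus> a \<otimes> b" by (auto simp: a_r_coset_def')
  then have "i \<oplus> a \<otimes> b \<in> Units R" using Units_one_closed by metis
  moreover have "i \<notin> Units R" using i I.unit_imp_carrier I(2) by blast
  ultimately have "a \<otimes> b \<in> Units R" using sum_unit_imp_unit i a b I.Icarr by blast
  then show ?thesis using unit_factor a b by blast
qed

section \<open>Skew hermitian modules and their quasi-reflections\<close>

locale skew_hermitian_module = module R M for R (structure) and M (structure) +
  fixes star h
  assumes involution: "ring_involution R star"
    and form: "skew_hermitian_form R star M h"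
begin

lemma star_hom: "star \<in> ring_hom R R"
  and star_star [simp]: "a \<in> carrier R \<Longrightarrow> star (star a) = a"
  using involution by (auto simp: ring_involution_def ring_iso_def)

lemma star_closed [simp, intro]: "a \<in> carrier R \<Longrightarrow> star a \<in> carrier R"
  by (rule ring_hom_closed[OF star_hom])

lemma star_mult [simp]: "a \<in> carrier R \<Longrightarrow> b \<in> carrier R \<Longrightarrow> star (a \<otimes> b) = star a \<otimes> star b"
  by (rule ring_hom_mult[OF star_hom])

lemma star_add [simp]: "a \<in> carrier R \<Longrightarrow> b \<in> carrier R \<Longrightarrow> star (a \<oplus> b) = star a \<oplus> star b"
  by (rule ring_hom_add[OF star_hom])

lemma star_one [simp]: "star \<one> = \<one>"
  by (rule ring_hom_one[OF star_hom])

lemma star_zero [simp]: "star \<zero> = \<zero>"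
  by (rule ring_hom_zero[OF star_hom R.ring_axioms R.ring_axioms])

lemma star_minus [simp]: "a \<in> carrier R \<Longrightarrow> star (\<ominus> a) = \<ominus> star a"
  using star_add[of "\<ominus> a" a] by (simp add: R.l_neg R.minus_equality)

lemma star_Units:
  assumes "a \<in> Units R"
  shows "star a \<in> Units R"
proof -
  have "star a \<otimes> star (inv a) = \<one>" "star (inv a) \<otimes> star a = \<one>"
    using assms star_mult[of a "inv a"] star_mult[of "inv a" a] by (simp_all add: R.Units_closed)
  moreover have "star a \<in> carrier R" "star (inv a) \<in> carrier R"
    using assms by (simp_all add: R.Units_closed)
  ultimately show ?thesis unfolding Units_def by blast
qed

lemma star_inv: "a \<in> Units R \<Longrightarrow> star (inv a) = inv (star a)"
  by (rule R.inv_char[symmetric]) (simp_all add: R.Units_closed flip: star_mult)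

lemma h_closed [simp, intro]: "x \<in> carrier M \<Longrightarrow> y \<in> carrier M \<Longrightarrow> h x y \<in> carrier R"
  and h_add_left: "x \<in> carrier M \<Longrightarrow> y \<in> carrier M \<Longrightarrow> z \<in> carrier M \<Longrightarrow>
    h (x \<oplus>\<^bsub>M\<^esub> y) z = h x z \<oplus> h y z"
  and h_add_right: "x \<in> carrier M \<Longrightarrow> y \<in> carrier M \<Longrightarrow> z \<in> carrier M \<Longrightarrow>
    h x (y \<oplus>\<^bsub>M\<^esub> z) = h x y \<oplus> h x z"
  and h_smult_right: "a \<in> carrier R \<Longrightarrow> x \<in> carrier M \<Longrightarrow> y \<in> carrier M \<Longrightarrow>
    h x (a \<odot>\<^bsub>M\<^esub> y) = a \<otimes> h x y"
  and star_h: "x \<in> carrier M \<Longrightarrow> y \<in> carrier M \<Longrightarrow> star (h x y) = \<ominus> h y x"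
  using form unfolding skew_hermitian_form_def by blast+

lemma h_swap: "x \<in> carrier M \<Longrightarrow> y \<in> carrier M \<Longrightarrow> h y x = \<ominus> star (h x y)"
  by (simp add: star_h)

lemma h_smult_left:
  "a \<in> carrier R \<Longrightarrow> x \<in> carrier M \<Longrightarrow> y \<in> carrier M \<Longrightarrow> h (a \<odot>\<^bsub>M\<^esub> x) y = star a \<otimes> h x y"
  by (subst h_swap) (simp_all add: h_smult_right star_h R.r_minus)

lemma h_zero_left [simp]: "x \<in> carrier M \<Longrightarrow> h \<zero>\<^bsub>M\<^esub> x = \<zero>"
  using h_smult_left[of \<zero> "\<zero>\<^bsub>M\<^esub>" x] by simp

lemma h_zero_right [simp]: "x \<in> carrier M \<Longrightarrow> h x \<zero>\<^bsub>M\<^esub> = \<zero>"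
  using h_smult_right[of \<zero> x "\<zero>\<^bsub>M\<^esub>"] by simp

lemma h_minus_left: "x \<in> carrier M \<Longrightarrow> y \<in> carrier M \<Longrightarrow> h (\<ominus>\<^bsub>M\<^esub> x) y = \<ominus> h x y"
  using h_add_left[of "\<ominus>\<^bsub>M\<^esub> x" x y] by (simp add: M.l_neg R.minus_equality)

lemma h_minus_right: "x \<in> carrier M \<Longrightarrow> y \<in> carrier M \<Longrightarrow> h x (\<ominus>\<^bsub>M\<^esub> y) = \<ominus> h x y"
  using h_add_right[of x "\<ominus>\<^bsub>M\<^esub> y" y] by (simp add: M.l_neg R.minus_equality)

lemma h_eq_zero_commute: "x \<in> carrier M \<Longrightarrow> y \<in> carrier M \<Longrightarrow> h x y = \<zero> \<longleftrightarrow> h y x = \<zero>"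
  by (metis h_swap R.minus_zero star_zero)

abbreviation "U \<equiv> unitary_group R M h"

lemma unitaryI:
  assumes ext: "g \<in> extensional (carrier M)"
    and inverse: "\<And>x. x \<in> carrier M \<Longrightarrow> g x \<in> carrier M" "\<And>x. x \<in> carrier M \<Longrightarrow> g' x \<in> carrier M"
      "\<And>x. x \<in> carrier M \<Longrightarrow> g' (g x) = x" "\<And>x. x \<in> carrier M \<Longrightarrow> g (g' x) = x"
    and "\<And>x y. x \<in> carrier M \<Longrightarrow> y \<in> carrier M \<Longrightarrow> g (x \<oplus>\<^bsub>M\<^esub> y) = g x \<oplus>\<^bsub>M\<^esub> g y"
    and "\<And>a x. a \<in> carrier R \<Longrightarrow> x \<in> carrier M \<Longrightarrow> g (a \<odot>\<^bsub>M\<^esub> x) = a \<odot>\<^bsub>M\<^esub> g x"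
    and "\<And>x y. x \<in> carrier M \<Longrightarrow> y \<in> carrier M \<Longrightarrow> h (g x) (g y) = h x y"
  shows "g \<in> carrier U"
proof -
  have "bij_betw g (carrier M) (carrier M)"
    by (rule bij_betw_byWitness[where f' = g']) (use inverse in auto)
  then show ?thesis using assms by (simp add: unitary_group_def Bij_def)
qed

lemma unitary_Bij: "g \<in> carrier U \<Longrightarrow> g \<in> Bij (carrier M)"
  and unitary_closed [simp, intro]: "g \<in> carrier U \<Longrightarrow> x \<in> carrier M \<Longrightarrow> g x \<in> carrier M"
  and unitary_add: "g \<in> carrier U \<Longrightarrow> x \<in> carrier M \<Longrightarrow> y \<in> carrier M \<Longrightarrow>
    g (x \<oplus>\<^bsub>M\<^esub> y) = g x \<oplus>\<^bsub>M\<^esub> g y"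
  and unitary_smult: "g \<in> carrier U \<Longrightarrow> a \<in> carrier R \<Longrightarrow> x \<in> carrier M \<Longrightarrow>
    g (a \<odot>\<^bsub>M\<^esub> x) = a \<odot>\<^bsub>M\<^esub> g x"
  and unitary_h: "g \<in> carrier U \<Longrightarrow> x \<in> carrier M \<Longrightarrow> y \<in> carrier M \<Longrightarrow> h (g x) (g y) = h x y"
  by (auto simp: unitary_group_def Bij_def dest: bij_betwE)

lemma unitary_mult: "g \<in> carrier U \<Longrightarrow> k \<in> carrier U \<Longrightarrow> g \<otimes>\<^bsub>U\<^esub> k = compose (carrier M) g k"
  by (simp add: unitary_group_def BijGroup_def)

lemma unitary_one: "\<one>\<^bsub>U\<^esub> = (\<lambda>x\<in>carrier M. x)"
  by (simp add: unitary_group_def BijGroup_def)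

lemma unitary_mult_apply:
  "g \<in> carrier U \<Longrightarrow> k \<in> carrier U \<Longrightarrow> x \<in> carrier M \<Longrightarrow> (g \<otimes>\<^bsub>U\<^esub> k) x = g (k x)"
  by (simp add: unitary_mult compose_eq)

lemma unitary_group_is_group: "group U"
proof -
  interpret B: group "BijGroup (carrier M)" by (rule group_BijGroup)
  have "subgroup (carrier U) (BijGroup (carrier M))"
  proof (rule B.subgroupI)
    show "carrier U \<subseteq> carrier (BijGroup (carrier M))"
      by (auto simp: BijGroup_def dest: unitary_Bij)
    have "(\<lambda>x\<in>carrier M. x) \<in> carrier U"
      by (rule unitaryI[where g' = "\<lambda>x. x"]) auto
    then show "carrier U \<noteq> {}" by blast
  next
    fix g assume g: "g \<in> carrier U"
    define k where "k = (\<lambda>x\<in>carrier M. inv_into (carrier M) g x)"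
    have bij: "bij_betw g (carrier M) (carrier M)" using unitary_Bij[OF g] by (simp add: Bij_def)
    have k: "k x \<in> carrier M" "k (g x) = x" "g (k x) = x" if "x \<in> carrier M" for x
      using that bij g
      by (auto simp: k_def bij_betw_inv_into_left bij_betw_inv_into_right bij_betwE[OF bij_betw_inv_into])
    have inj: "x = y" if "x \<in> carrier M" "y \<in> carrier M" "g x = g y" for x y
      using that k(2) by metis
    have "k \<in> carrier U"
    proof (rule unitaryI[where g' = g])
      show "k (x \<oplus>\<^bsub>M\<^esub> y) = k x \<oplus>\<^bsub>M\<^esub> k y" if "x \<in> carrier M" "y \<in> carrier M" for x y
        by (rule inj) (use that k g in \<open>auto simp: unitary_add\<close>)
      show "k (a \<odot>\<^bsub>M\<^esub> x) = a \<odot>\<^bsub>M\<^esub> k x" if "a \<in> carrier R" "x \<in> carrier M" for a x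
        by (rule inj) (use that k g in \<open>auto simp: unitary_smult\<close>)
      show "h (k x) (k y) = h x y" if "x \<in> carrier M" "y \<in> carrier M" for x y
        using unitary_h[OF g, of "k x" "k y"] that k by simp
    qed (use k g in \<open>auto simp: k_def\<close>)
    then show "inv\<^bsub>BijGroup (carrier M)\<^esub> g \<in> carrier U"
      using unitary_Bij[OF g] by (simp add: inv_BijGroup k_def)
  next
    fix g k assume g: "g \<in> carrier U" and k: "k \<in> carrier U"
    let ?c = "compose (carrier M) g k"
    have "?c \<in> Bij (carrier M)"
      using unitary_Bij[OF g] unitary_Bij[OF k] by (rule compose_Bij)
    moreover have "?c (x \<oplus>\<^bsub>M\<^esub> y) = ?c x \<oplus>\<^bsub>M\<^esub> ?c y"
      if "x \<in> carrier M" "y \<in> carrier M" for x y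
      using that g k by (simp add: compose_eq unitary_add)
    moreover have "?c (a \<odot>\<^bsub>M\<^esub> x) = a \<odot>\<^bsub>M\<^esub> ?c x" if "a \<in> carrier R" "x \<in> carrier M" for a x
      using that g k by (simp add: compose_eq unitary_smult)
    moreover have "h (?c x) (?c y) = h x y" if "x \<in> carrier M" "y \<in> carrier M" for x y
      using that g k by (simp add: compose_eq unitary_h)
    ultimately have "?c \<in> carrier U"
      unfolding unitary_group_def by simp
    then show "g \<otimes>\<^bsub>BijGroup (carrier M)\<^esub> k \<in> carrier U"
      using unitary_Bij[OF g] unitary_Bij[OF k] by (simp add: BijGroup_def)
  qed
  then have "group (BijGroup (carrier M) \<lparr>carrier := carrier U\<rparr>)"
    by (rule B.subgroup_imp_group)
  then show ?thesis by (simp add: unitary_group_def)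
qed

end

text \<open>These maps fix every vector orthogonal to \<open>w\<close>. For \<open>h(w, w) = 0\<close> they are unitary transvections, and
  in general they play the role that reflections play for quadratic forms.\<close>

definition quasi_reflection ::
  "('a, 'm) ring_scheme \<Rightarrow> ('a, 'b, 'n) module_scheme \<Rightarrow> ('b \<Rightarrow> 'b \<Rightarrow> 'a) \<Rightarrow> 'b \<Rightarrow> 'a \<Rightarrow> 'b \<Rightarrow> 'b" where
  "quasi_reflection R M h w a = (\<lambda>z\<in>carrier M. z \<oplus>\<^bsub>M\<^esub> (a \<otimes>\<^bsub>R\<^esub> h w z) \<odot>\<^bsub>M\<^esub> w)"

text \<open>The equation for \<open>a\<close> makes the map preserve \<open>h\<close>; dividing by \<open>a* a\<close> turns it into
  \<open>c - c* + h(w, w) = 0\<close> for \<open>c = 1/a\<close>.\<close>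

definition quasi_reflections ::
  "('a, 'm) ring_scheme \<Rightarrow> ('a \<Rightarrow> 'a) \<Rightarrow> ('a, 'b, 'n) module_scheme \<Rightarrow> ('b \<Rightarrow> 'b \<Rightarrow> 'a) \<Rightarrow> ('b \<Rightarrow> 'b) set" where
  "quasi_reflections R star M h =
     {quasi_reflection R M h w a | w a. w \<in> carrier M \<and> a \<in> Units R \<and>
        a = star a \<oplus>\<^bsub>R\<^esub> star a \<otimes>\<^bsub>R\<^esub> a \<otimes>\<^bsub>R\<^esub> h w w}"

context skew_hermitian_module begin

text \<open>The composite is \<open>z + (a + b + a b h(w, w)) h(w, z) w\<close>.\<close>

lemma quasi_reflection_quasi_reflection:
  assumes w: "w \<in> carrier M" and z: "z \<in> carrier M" and a: "a \<in> carrier R" and b: "b \<in> carrier R"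
    and ab: "a \<oplus> b \<oplus> a \<otimes> b \<otimes> h w w = \<zero>"
  shows "quasi_reflection R M h w a (quasi_reflection R M h w b z) = z"
proof -
  define p q where "p = h w z" and "q = h w w"
  have pq: "p \<in> carrier R" "q \<in> carrier R" using w z by (auto simp: p_def q_def)
  have "b \<otimes> p \<oplus> a \<otimes> (p \<oplus> b \<otimes> p \<otimes> q) = (a \<oplus> b \<oplus> a \<otimes> b \<otimes> q) \<otimes> p"
    using a b pq by algebra
  also have "\<dots> = \<zero>" using ab pq by (simp add: q_def)
  finally have *: "b \<otimes> p \<oplus> a \<otimes> (p \<oplus> b \<otimes> p \<otimes> q) = \<zero>" .
  have "quasi_reflection R M h w a (quasi_reflection R M h w b z)
      = z \<oplus>\<^bsub>M\<^esub> (b \<otimes> p \<oplus> a \<otimes> (p \<oplus> b \<otimes> p \<otimes> q)) \<odot>\<^bsub>M\<^esub> w"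
    using w z a b pq
    by (simp add: quasi_reflection_def h_add_right h_smult_right smult_l_distr M.a_assoc
        flip: p_def q_def)
  then show ?thesis using * w z by simp
qed

text \<open>For fixed \<open>w\<close>, the inverse belongs to the scalar \<open>-a*\<close>. Expanding \<open>h\<close> of two images leaves the
  error term \<open>(a - a* - a* a h(w, w)) h(x, w) h(w, y)\<close>, which vanishes.\<close>

lemma quasi_reflection_unitary:
  assumes w: "w \<in> carrier M" and a: "a \<in> carrier R"
    and cond: "a = star a \<oplus> star a \<otimes> a \<otimes> h w w"
  shows "quasi_reflection R M h w a \<in> carrier U"
proof (rule unitaryI[where g' = "quasi_reflection R M h w (\<ominus> star a)"])
  define q where "q = h w w"
  have q: "q \<in> carrier R" and c: "a = star a \<oplus> star a \<otimes> a \<otimes> q"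
    using w cond by (auto simp: q_def)
  have "a \<oplus> \<ominus> star a \<oplus> a \<otimes> \<ominus> star a \<otimes> q = a \<oplus> \<ominus> (star a \<oplus> star a \<otimes> a \<otimes> q)"
    using a q star_closed[OF a] by algebra
  also have "\<dots> = \<zero>" using c a by (simp add: R.r_neg)
  finally have i: "a \<oplus> \<ominus> star a \<oplus> a \<otimes> \<ominus> star a \<otimes> h w w = \<zero>" by (simp add: q_def)
  then have i': "\<ominus> star a \<oplus> a \<oplus> \<ominus> star a \<otimes> a \<otimes> h w w = \<zero>"
    using a w by (simp add: R.a_comm R.m_comm)
  fix x assume x: "x \<in> carrier M"
  show "quasi_reflection R M h w (\<ominus> star a) (quasi_reflection R M h w a x) = x"
    "quasi_reflection R M h w a (quasi_reflection R M h w (\<ominus> star a) x) = x"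
    using quasi_reflection_quasi_reflection[OF w x] i i' a by simp_all
next
  fix x y assume x: "x \<in> carrier M" and y: "y \<in> carrier M"
  define p p' q where "p = h x w" and "p' = h w y" and "q = h w w"
  have pq: "p \<in> carrier R" "p' \<in> carrier R" "q \<in> carrier R"
    using w x y by (auto simp: p_def q_def p'_def)
  have wx: "star (h w x) = \<ominus> p" using w x by (simp add: star_h p_def)
  have c: "a = star a \<oplus> star a \<otimes> a \<otimes> q" using cond by (simp add: q_def)
  have "h (quasi_reflection R M h w a x) (quasi_reflection R M h w a y)
     = h x y \<oplus> star a \<otimes> \<ominus> p \<otimes> p' \<oplus> a \<otimes> p' \<otimes> (p \<oplus> star a \<otimes> \<ominus> p \<otimes> q)"
    using w x y a pq
    by (simp add: quasi_reflection_def h_add_right h_add_left h_smult_right h_smult_left wx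
        flip: p_def q_def p'_def)
  also have "\<dots> = h x y \<oplus> (a \<oplus> \<ominus> (star a \<oplus> star a \<otimes> a \<otimes> q)) \<otimes> (p \<otimes> p')"
    using a star_closed[OF a] pq h_closed[OF x y] by algebra
  also have "\<dots> = h x y"
    using a x y pq by (simp add: R.r_neg flip: c)
  finally show "h (quasi_reflection R M h w a x) (quasi_reflection R M h w a y) = h x y" .
next
  fix x y assume x: "x \<in> carrier M" and y: "y \<in> carrier M"
  show "quasi_reflection R M h w a (x \<oplus>\<^bsub>M\<^esub> y)
      = quasi_reflection R M h w a x \<oplus>\<^bsub>M\<^esub> quasi_reflection R M h w a y"
    using w x y a by (simp add: quasi_reflection_def h_add_right R.r_distr smult_l_distr M.a_ac)
next
  fix b x assume "b \<in> carrier R" and "x \<in> carrier M"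
  then show "quasi_reflection R M h w a (b \<odot>\<^bsub>M\<^esub> x) = b \<odot>\<^bsub>M\<^esub> quasi_reflection R M h w a x"
    using w a
    by (simp add: quasi_reflection_def h_smult_right smult_r_distr R.m_lcomm flip: smult_assoc1)
qed (use w a in \<open>auto simp: quasi_reflection_def\<close>)

lemma quasi_reflections_subset_unitary: "quasi_reflections R star M h \<subseteq> carrier U"
  by (auto simp: quasi_reflections_def intro!: quasi_reflection_unitary)

lemma quasi_reflection_fixes:
  assumes "w \<in> carrier M" "z \<in> carrier M" "a \<in> carrier R" "h w z = \<zero>"
  shows "quasi_reflection R M h w a z = z"
  using assms by (simp add: quasi_reflection_def)

text \<open>With \<open>w = x - y\<close>, the requirement that \<open>x\<close> goes to \<open>x - w\<close> forces \<open>a h(w, x) = -1\<close>, that is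
  \<open>1/a = h(y, x)\<close>, and isotropy of \<open>x\<close> and \<open>y\<close> makes this scalar admissible. A vector \<open>z\<close> with
  \<open>h(x, z) = h(y, z)\<close> is orthogonal to \<open>w\<close>, hence fixed.\<close>

lemma exists_quasi_reflection:
  assumes x: "x \<in> carrier M" and y: "y \<in> carrier M"
    and xx: "h x x = \<zero>" and yy: "h y y = \<zero>" and unit: "h y x \<in> Units R"
  shows "\<exists>\<rho>\<in>quasi_reflections R star M h. \<rho> x = y \<and>
    (\<forall>z\<in>carrier M. h x z = h y z \<longrightarrow> \<rho> z = z)"
proof -
  define w where "w = x \<oplus>\<^bsub>M\<^esub> \<ominus>\<^bsub>M\<^esub> y"
  define c where "c = h y x"
  have w: "w \<in> carrier M" and c: "c \<in> Units R" "c \<in> carrier R" "star c \<in> carrier R"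
    using x y unit by (auto simp: w_def c_def)
  have xy: "h x y = \<ominus> star c" using h_swap[OF y x] by (simp add: c_def)
  have ww: "h w w = star c \<oplus> \<ominus> c"
    using x y c by (simp add: w_def h_add_left h_add_right h_minus_left h_minus_right xx yy xy R.a_comm
        flip: c_def)
  have wx: "h w x = \<ominus> c"
    using x y c by (simp add: w_def h_add_left h_minus_left xx flip: c_def)
  define a where "a = inv c"
  have a: "a \<in> Units R" "a \<in> carrier R" "star a \<in> carrier R" "a \<otimes> c = \<one>" "star a \<otimes> star c = \<one>"
    using c star_Units[OF c(1)] by (auto simp: a_def star_inv)
  have "star a \<oplus> star a \<otimes> a \<otimes> (star c \<oplus> \<ominus> c) 
      = (star a \<oplus> (star a \<otimes> star c) \<otimes> a) \<oplus> \<ominus> (star a \<otimes> (a \<otimes> c))"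
    using a(2,3) c(2,3) by algebra
  also have "\<dots> = a" using a by (simp, simp add: R.a_ac R.r_neg)
  finally have cond: "a = star a \<oplus> star a \<otimes> a \<otimes> h w w" by (simp add: ww)
  have "quasi_reflection R M h w a x = x \<oplus>\<^bsub>M\<^esub> (\<ominus> (a \<otimes> c)) \<odot>\<^bsub>M\<^esub> w"
    using x w c a by (simp add: quasi_reflection_def wx R.r_minus)
  also have "\<dots> = x \<oplus>\<^bsub>M\<^esub> \<ominus>\<^bsub>M\<^esub> w" using a w by (simp add: smult_l_minus)
  also have "\<dots> = y" using x y
    by (simp add: w_def M.minus_add M.r_neg M.r_neg1 M.a_assoc[symmetric])
  finally have 1: "quasi_reflection R M h w a x = y" .
  have 2: "quasi_reflection R M h w a z = z" if "z \<in> carrier M" "h x z = h y z" for z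
    by (rule quasi_reflection_fixes)
      (use that w a x y in \<open>auto simp: w_def h_add_left h_minus_left R.r_neg\<close>)
  show ?thesis
    using w a cond 1 2 by (auto simp: quasi_reflections_def)
qed

end

section \<open>Generation of the unitary group by quasi-reflections\<close>

text \<open>Locality enters only through sums of units, and the symplectic basis only through its Gram matrix and
  the fact that it spans. In this form the assumptions pass to \<open>V/IV\<close> without any computation with
  linear combinations of cosets.\<close>

locale local_symplectic_module = skew_hermitian_module R M star h
  for R (structure) and M (structure) and star h +
  fixes m :: nat and u v
  assumes sum_unit: "a \<in> carrier R \<Longrightarrow> b \<in> carrier R \<Longrightarrow> a \<oplus> b \<in> Units R \<Longrightarrow> a \<in> Units R \<or> b \<in> Units R"
    and zero_not_unit: "\<zero> \<notin> Units R"
    and uv_closed: "i < m \<Longrightarrow> u i \<in> carrier M" "i < m \<Longrightarrow> v i \<in> carrier M"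
    and h_u_v: "i < m \<Longrightarrow> j < m \<Longrightarrow> h (u i) (v j) = (if i = j then \<one> else \<zero>)"
    and h_u_u: "i < m \<Longrightarrow> j < m \<Longrightarrow> h (u i) (u j) = \<zero>"
    and h_v_v: "i < m \<Longrightarrow> j < m \<Longrightarrow> h (v i) (v j) = \<zero>"
    and spanning: "submodule N R M \<Longrightarrow> (\<And>i. i < m \<Longrightarrow> u i \<in> N \<and> v i \<in> N) \<Longrightarrow> carrier M \<subseteq> N"
begin

sublocale U: group U by (rule unitary_group_is_group)

abbreviation "G \<equiv> generate U (quasi_reflections R star M h)"

lemma G_subgroup: "subgroup G U"
  by (rule U.generate_is_subgroup[OF quasi_reflections_subset_unitary])

lemma G_unitary: "g \<in> G \<Longrightarrow> g \<in> carrier U"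
  using U.generate_in_carrier[OF quasi_reflections_subset_unitary] .

lemma h_v_u: "i < m \<Longrightarrow> j < m \<Longrightarrow> h (v i) (u j) = (if i = j then \<ominus> \<one> else \<zero>)"
  using h_swap[of "u j" "v i"] by (auto simp: h_u_v uv_closed)

lemma minus_unit_iff: "a \<in> carrier R \<Longrightarrow> \<ominus> a \<in> Units R \<longleftrightarrow> a \<in> Units R"
  by (metis R.Units_m_closed R.Units_minus_one_closed R.l_minus R.l_one R.minus_minus R.one_closed
      R.a_inv_closed)

text \<open>Otherwise \<open>b = (a \<oplus> b) \<oplus> (\<ominus> a)\<close> would be a sum of two nonunits.\<close>

lemma add_nonunit_unit:
  assumes "a \<in> carrier R" "a \<notin> Units R" "b \<in> Units R"
  shows "a \<oplus> b \<in> Units R"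
proof -
  have b: "b \<in> carrier R" using assms(3) by (rule R.Units_closed)
  have "(a \<oplus> b) \<oplus> \<ominus> a = b"
    using assms(1) b by algebra
  then show ?thesis
    using sum_unit[of "a \<oplus> b" "\<ominus> a"] assms b minus_unit_iff by auto
qed

text \<open>If \<open>x\<close> paired to nonunits with all basis vectors, it would do so with everything, because the vectors
  pairing to a nonunit with \<open>x\<close> form a submodule over a local ring.\<close>

lemma exists_basis_vector_pairing_to_unit:
  assumes x: "x \<in> carrier M" and y: "y \<in> carrier M" and unit: "h y x \<in> Units R"
  shows "\<exists>i<m. h (u i) x \<in> Units R \<or> h (v i) x \<in> Units R"
proof (rule ccontr)
  assume neg: "\<not> ?thesis"
  define N where "N = {z \<in> carrier M. h z x \<notin> Units R}"
  have "submodule N R M"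
  proof (rule submoduleI)
    show "\<ominus>\<^bsub>M\<^esub> z \<in> N" if "z \<in> N" for z
      using that x by (auto simp: N_def h_minus_left minus_unit_iff)
    show "w \<oplus>\<^bsub>M\<^esub> z \<in> N" if "w \<in> N" "z \<in> N" for w z
      using that x sum_unit[of "h w x" "h z x"] by (auto simp: N_def h_add_left)
    show "a \<odot>\<^bsub>M\<^esub> z \<in> N" if "a \<in> carrier R" "z \<in> N" for a z
      using that x R.unit_factor[of "h z x" "star a"] by (auto simp: N_def h_smult_left R.m_comm)
  qed (use x zero_not_unit in \<open>auto simp: N_def\<close>)
  then have "carrier M \<subseteq> N"
    using neg by (rule_tac spanning) (auto simp: N_def uv_closed)
  then show False using y unit by (auto simp: N_def)
qed

lemma exists_generated_one_step:
  assumes "x \<in> carrier M" "y \<in> carrier M" "h x x = \<zero>" "h y y = \<zero>" "h y x \<in> Units R"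
  shows "\<exists>\<rho>\<in>G. \<rho> x = y \<and> (\<forall>t\<in>carrier M. h x t = h y t \<longrightarrow> \<rho> t = t)"
  using exists_quasi_reflection[OF assms] generate.incl[of _ "quasi_reflections R star M h" U] by blast

text \<open>When \<open>h(y, x)\<close> is not a unit, an intermediate \<open>z\<close> still connects \<open>x\<close> to \<open>y\<close>. Vectors whose pairings
  with \<open>x\<close>, \<open>z\<close> and \<open>y\<close> agree are not moved.\<close>

lemma exists_generated_two_step:
  assumes x: "x \<in> carrier M" "h x x = \<zero>" and z: "z \<in> carrier M" "h z z = \<zero>"
    and y: "y \<in> carrier M" "h y y = \<zero>" and units: "h z x \<in> Units R" "h y z \<in> Units R"
  shows "\<exists>\<rho>\<in>G. \<rho> x = y \<and> (\<forall>t\<in>carrier M. h x t = h z t \<longrightarrow> h z t = h y t \<longrightarrow> \<rho> t = t)"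
proof -
  obtain \<rho> where \<rho>: "\<rho> \<in> G" "\<rho> x = z" "\<And>t. t \<in> carrier M \<Longrightarrow> h x t = h z t \<Longrightarrow> \<rho> t = t"
    using exists_generated_one_step[OF x(1) z(1) x(2) z(2) units(1)] by blast
  obtain \<sigma> where \<sigma>: "\<sigma> \<in> G" "\<sigma> z = y" "\<And>t. t \<in> carrier M \<Longrightarrow> h z t = h y t \<Longrightarrow> \<sigma> t = t"
    using exists_generated_one_step[OF z(1) y(1) z(2) y(2) units(2)] by blast
  have "\<sigma> \<otimes>\<^bsub>U\<^esub> \<rho> \<in> G" using \<rho>(1) \<sigma>(1) by (rule_tac generate.eng)
  then show ?thesis
    using \<rho> \<sigma> x(1) by (intro bexI[of _ "\<sigma> \<otimes>\<^bsub>U\<^esub> \<rho>"]) (auto simp: unitary_mult_apply G_unitary)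
qed

text \<open>The intermediate vector must pair to a unit with both \<open>x\<close> and \<open>u k\<close>. The vector \<open>v k\<close> always
  does the latter. If it fails with \<open>x\<close>, adding a basis vector \<open>r\<close> that pairs to a unit with \<open>x\<close>
  repairs this, and \<open>v k \<oplus> r\<close> stays isotropic because \<open>r\<close> belongs to a later pair.\<close>

lemma move_to_u:
  assumes k: "k < m" and x: "x \<in> carrier M" "h x x = \<zero>" and y: "y \<in> carrier M" "h y x \<in> Units R"
    and orth: "\<And>i. i < k \<Longrightarrow> h x (u i) = \<zero> \<and> h x (v i) = \<zero>"
  shows "\<exists>\<rho>\<in>G. \<rho> x = u k \<and> (\<forall>i<k. \<rho> (u i) = u i \<and> \<rho> (v i) = v i)"
proof -
  note hs = h_u_u h_v_v h_u_v h_v_u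
  have uk: "u k \<in> carrier M" "h (u k) (u k) = \<zero>" and vk: "v k \<in> carrier M" "h (v k) (v k) = \<zero>"
    using k by (simp_all add: uv_closed hs)
  have two_step: ?thesis
    if z: "z \<in> carrier M" "h z z = \<zero>" and units: "h z x \<in> Units R" "h (u k) z \<in> Units R"
      and z_orth: "\<And>i. i < k \<Longrightarrow> h z (u i) = \<zero> \<and> h z (v i) = \<zero>" for z
  proof -
    obtain \<rho> where "\<rho> \<in> G" "\<rho> x = u k"
      "\<And>t. t \<in> carrier M \<Longrightarrow> h x t = h z t \<Longrightarrow> h z t = h (u k) t \<Longrightarrow> \<rho> t = t"
      using exists_generated_two_step[OF x z uk units] by blast
    then show ?thesis
      using orth z_orth k by (intro bexI[of _ \<rho>]) (auto simp: uv_closed hs)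
  qed
  consider "h (u k) x \<in> Units R" | "h (v k) x \<in> Units R"
    | "h (u k) x \<notin> Units R" "h (v k) x \<notin> Units R" by blast
  then show ?thesis
  proof cases
    case 1
    obtain \<rho> where "\<rho> \<in> G" "\<rho> x = u k" "\<And>t. t \<in> carrier M \<Longrightarrow> h x t = h (u k) t \<Longrightarrow> \<rho> t = t"
      using exists_generated_one_step[OF x(1) uk(1) x(2) uk(2) 1] by blast
    then show ?thesis using orth k by (intro bexI[of _ \<rho>]) (auto simp: uv_closed hs)
  next
    case 2
    show ?thesis using two_step[OF vk 2] k by (auto simp: hs)
  next
    case 3
    obtain i where i: "i < m" "h (u i) x \<in> Units R \<or> h (v i) x \<in> Units R"
      using exists_basis_vector_pairing_to_unit[OF x(1) y] by blast
    define r where "r = (if h (u i) x \<in> Units R then u i else v i)"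
    have r: "r \<in> carrier M" "h r x \<in> Units R" "r = u i \<or> r = v i"
      using i by (auto simp: r_def uv_closed)
    have "i \<noteq> k" using i 3 by blast
    \<comment> \<open>The vector \<open>x\<close> is orthogonal to the earlier pairs, and \<open>\<zero>\<close> is not a unit.\<close>
    have "\<not> i < k"
    proof
      assume "i < k"
      then have "h x r = \<zero>" using orth r(3) by auto
      then show False using r x h_eq_zero_commute[of x r] zero_not_unit by simp
    qed
    have ir: "h r r = \<zero>" "h r (v k) = \<zero>" "h (v k) r = \<zero>" "h (u k) r = \<zero>"
      "\<And>j. j < k \<Longrightarrow> h r (u j) = \<zero> \<and> h r (v j) = \<zero>"
      using r(3) i(1) k \<open>i \<noteq> k\<close> \<open>\<not> i < k\<close> by (auto simp: hs)
    show ?thesis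
    proof (rule two_step[of "v k \<oplus>\<^bsub>M\<^esub> r"])
      show "h (v k \<oplus>\<^bsub>M\<^esub> r) x \<in> Units R"
        using add_nonunit_unit[of "h (v k) x" "h r x"] vk r x 3 by (simp add: h_add_left)
    qed (use vk uk r ir k in \<open>auto simp: h_add_left h_add_right hs uv_closed\<close>)
  qed
qed

text \<open>Both \<open>y\<close> and \<open>v k\<close> pair to the same value with \<open>u k\<close>, so a quasi-reflection from one to the other
  fixes \<open>u k\<close>. If \<open>h (v k) y\<close> is not a unit, the detour goes through \<open>v k \<oplus> u k\<close>, which has that same
  pairing with \<open>u k\<close>.\<close>

lemma move_to_v:
  assumes k: "k < m" and y: "y \<in> carrier M" "h y y = \<zero>" and uy: "h (u k) y = \<one>"
    and orth: "\<And>i. i < k \<Longrightarrow> h y (u i) = \<zero> \<and> h y (v i) = \<zero>"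
  shows "\<exists>\<rho>\<in>G. \<rho> y = v k \<and> \<rho> (u k) = u k \<and> (\<forall>i<k. \<rho> (u i) = u i \<and> \<rho> (v i) = v i)"
proof -
  note hs = h_u_u h_v_v h_u_v h_v_u
  have uk: "u k \<in> carrier M" and vk: "v k \<in> carrier M" "h (v k) (v k) = \<zero>"
    using k by (simp_all add: uv_closed hs)
  have yu: "h y (u k) = \<ominus> \<one>" using h_swap[OF uk y(1)] uy by simp
  show ?thesis
  proof (cases "h (v k) y \<in> Units R")
    case True
    obtain \<rho> where "\<rho> \<in> G" "\<rho> y = v k" "\<And>t. t \<in> carrier M \<Longrightarrow> h y t = h (v k) t \<Longrightarrow> \<rho> t = t"
      using exists_generated_one_step[OF y(1) vk(1) y(2) vk(2) True] by blast
    then show ?thesis using orth k yu by (intro bexI[of _ \<rho>]) (auto simp: uv_closed hs)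
  next
    case False
    define z where "z = v k \<oplus>\<^bsub>M\<^esub> u k"
    have z: "z \<in> carrier M" "h z z = \<zero>"
      using uk vk k by (auto simp: z_def h_add_left h_add_right hs R.l_neg R.r_neg)
    have "h z y \<in> Units R"
      using add_nonunit_unit[of "h (v k) y" \<one>] False uk vk y uy by (simp add: z_def h_add_left)
    moreover have "h (v k) z \<in> Units R"
      using uk vk k R.Units_minus_one_closed by (simp add: z_def h_add_right hs)
    ultimately obtain \<rho> where "\<rho> \<in> G" "\<rho> y = v k"
      "\<And>t. t \<in> carrier M \<Longrightarrow> h y t = h z t \<Longrightarrow> h z t = h (v k) t \<Longrightarrow> \<rho> t = t"
      using exists_generated_two_step[OF y z vk] by blast
    moreover have "h z (u k) = \<ominus> \<one>" "\<And>i. i < k \<Longrightarrow> h z (u i) = \<zero> \<and> h z (v i) = \<zero>"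
      using uk vk k by (auto simp: z_def h_add_left hs uv_closed)
    ultimately show ?thesis using orth k yu by (intro bexI[of _ \<rho>]) (auto simp: uv_closed hs)
  qed
qed

lemma unitary_eq_one:
  assumes g: "g \<in> carrier U" and fixed: "\<And>i. i < m \<Longrightarrow> g (u i) = u i \<and> g (v i) = v i"
  shows "g = \<one>\<^bsub>U\<^esub>"
proof -
  define N where "N = {z \<in> carrier M. g z = z}"
  have smult: "a \<odot>\<^bsub>M\<^esub> z \<in> N" if "a \<in> carrier R" "z \<in> N" for a z
    using that g by (auto simp: N_def unitary_smult)
  have "submodule N R M"
  proof (rule submoduleI)
    show "\<zero>\<^bsub>M\<^esub> \<in> N"
      using unitary_smult[OF g R.zero_closed M.zero_closed] g by (simp add: N_def)
    show "\<ominus>\<^bsub>M\<^esub> z \<in> N" if "z \<in> N" for z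
      using smult[of "\<ominus> \<one>" z] that by (simp add: N_def smult_l_minus)
  qed (use g smult in \<open>auto simp: N_def unitary_add\<close>)
  then have "carrier M \<subseteq> N"
    using fixed by (rule_tac spanning) (auto simp: N_def uv_closed)
  then show ?thesis
    using unitary_Bij[OF g] by (auto simp: unitary_one N_def Bij_def extensional_def fun_eq_iff)
qed

text \<open>Descending induction on the number of pairs already fixed; \<open>move_to_u\<close> and \<open>move_to_v\<close> fix one more
  pair without disturbing the earlier ones.\<close>

lemma fixing_initial_pairs_imp_generated:
  assumes "k \<le> m" "g \<in> carrier U" "\<And>i. i < k \<Longrightarrow> g (u i) = u i \<and> g (v i) = v i"
  shows "g \<in> G"
  using assms
proof (induction k arbitrary: g rule: inc_induct)
  case base
  then show ?case using unitary_eq_one generate.one by metis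
next
  case (step k)
  note g = step.prems(1) and fixed = step.prems(2)
  have k: "k < m" using step.hyps by simp
  then have uk: "u k \<in> carrier M" and vk: "v k \<in> carrier M" by (auto simp: uv_closed)
  have orth: "h (g t) (u i) = h t (u i) \<and> h (g t) (v i) = h t (v i)"
    if "i < k" "t \<in> carrier M" for i t
    using that unitary_h[OF g, of t "u i"] unitary_h[OF g, of t "v i"] fixed[of i] k
    by (simp add: uv_closed)
  have "h (g (v k)) (g (u k)) \<in> Units R"
    using k uk vk g R.Units_minus_one_closed by (simp add: unitary_h h_v_u)
  then obtain \<rho> where \<rho>: "\<rho> \<in> G" "\<rho> (g (u k)) = u k" "\<And>i. i < k \<Longrightarrow> \<rho> (u i) = u i \<and> \<rho> (v i) = v i"
    using move_to_u[OF k, of "g (u k)" "g (v k)"] g uk vk k orth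
    by (auto simp: unitary_h h_u_u h_u_v)
  define y where "y = \<rho> (g (v k))"
  note \<rho>U = G_unitary[OF \<rho>(1)]
  have y: "y \<in> carrier M" "h y y = \<zero>" using vk g \<rho>U k by (auto simp: y_def unitary_h h_v_v)
  have uy: "h (u k) y = \<one>"
    using unitary_h[OF \<rho>U, of "g (u k)" "g (v k)"] uk vk g k \<rho>(2)
    by (simp add: y_def unitary_h h_u_v)
  have "h y (u i) = \<zero> \<and> h y (v i) = \<zero>" if "i < k" for i
    using that k unitary_h[OF \<rho>U, of "g (v k)" "u i"] unitary_h[OF \<rho>U, of "g (v k)" "v i"]
      \<rho>(3)[OF that] orth[OF that vk] g vk by (simp add: y_def uv_closed h_v_u h_v_v)
  then obtain \<sigma> where \<sigma>: "\<sigma> \<in> G" "\<sigma> y = v k" "\<sigma> (u k) = u k"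
      "\<And>i. i < k \<Longrightarrow> \<sigma> (u i) = u i \<and> \<sigma> (v i) = v i"
    using move_to_v[OF k y uy] by blast
  note \<sigma>U = G_unitary[OF \<sigma>(1)]
  define \<tau> where "\<tau> = \<sigma> \<otimes>\<^bsub>U\<^esub> \<rho>"
  have \<tau>: "\<tau> \<in> G" "\<tau> \<in> carrier U" unfolding \<tau>_def using \<sigma>(1) \<rho>(1) \<rho>U \<sigma>U by (auto intro: generate.eng)
  have "\<tau> \<otimes>\<^bsub>U\<^esub> g \<in> G"
  proof (rule step.IH)
    show "\<tau> \<otimes>\<^bsub>U\<^esub> g \<in> carrier U" using \<tau> g by simp
    fix i assume "i < Suc k"
    then have i: "i < m" "i < k \<or> i = k" using k by auto
    show "(\<tau> \<otimes>\<^bsub>U\<^esub> g) (u i) = u i \<and> (\<tau> \<otimes>\<^bsub>U\<^esub> g) (v i) = v i"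
      using i(2) uv_closed[OF i(1)] fixed[of i] \<rho>(2) \<rho>(3)[of i] \<sigma>(2,3) \<sigma>(4)[of i] g \<tau>(2) \<rho>U \<sigma>U
      by (auto simp: \<tau>_def unitary_mult_apply y_def)
  qed
  then have "inv\<^bsub>U\<^esub> \<tau> \<otimes>\<^bsub>U\<^esub> (\<tau> \<otimes>\<^bsub>U\<^esub> g) \<in> G"
    using \<tau>(1) subgroup.m_closed[OF G_subgroup] subgroup.m_inv_closed[OF G_subgroup] by blast
  then show ?case using \<tau>(2) g by (simp flip: U.m_assoc)
qed

theorem unitary_group_generated_by_quasi_reflections: "G = carrier U"
  using fixing_initial_pairs_imp_generated[of 0] G_unitary by auto

end

section \<open>Reduction modulo an ideal\<close>

lemma (in module) finsum_in_submodule: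
  assumes N: "submodule N R M" and "finite A" and "\<And>i. i \<in> A \<Longrightarrow> f i \<in> N"
  shows "finsum M f A \<in> N"
  using assms(2,3)
proof (induction A rule: finite_induct)
  case empty
  then show ?case using subgroup.one_closed[OF submodule.axioms(1)[OF N]] by simp
next
  case (insert i A)
  then have "f \<in> insert i A \<rightarrow> carrier M" using submoduleE(1)[OF N] by blast
  then show ?case using insert submoduleE(5)[OF N] by (simp add: Pi_iff)
qed

lemma (in module) module_basis_spans:
  assumes basis: "module_basis R M J e" and N: "submodule N R M" and e: "e ` J \<subseteq> N"
  shows "carrier M \<subseteq> N"
proof
  fix x assume "x \<in> carrier M"
  then obtain c where c: "c \<in> J \<rightarrow> carrier R" "x = finsum M (\<lambda>i. c i \<odot>\<^bsub>M\<^esub> e i) J"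
    using basis by (auto simp: module_basis_def)
  have "finite J" using basis by (simp add: module_basis_def)
  then show "x \<in> N"
    using c e submoduleE(4)[OF N] finsum_in_submodule[OF N, of J] by (auto simp: Pi_iff image_subset_iff)
qed

lemma zero_FactRing: "\<zero>\<^bsub>R Quot I\<^esub> = I"
  by (simp add: FactRing_def)

locale form_reduction = skew_hermitian_module R M star h
  for R (structure) and M (structure) and star h +
  fixes I
  assumes ideal: "ideal I R" and star_I: "star ` I \<subseteq> I"
begin

abbreviation "red_scalar a \<equiv> I +> a"
abbreviation "red_vector x \<equiv> ideal_smult M I +>\<^bsub>M\<^esub> x"

sublocale I: ideal I R by (rule ideal)

sublocale red: skew_hermitian_module "R Quot I" "red_module M I" "red_star R I star" "red_form R I h"
proof (intro skew_hermitian_module.intro skew_hermitian_module_axioms.intro)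
  show "module (R Quot I) (red_module M I)"
    by (rule red_module_is_module[OF module_axioms ideal])
  show "ring_involution (R Quot I) (red_star R I star)"
    by (rule red_star_involution[OF module_axioms ideal involution star_I])
  show "skew_hermitian_form (R Quot I) (red_star R I star) (red_module M I) (red_form R I h)"
    by (rule red_form_skew_hermitian[OF module_axioms ideal form involution star_I])
qed

sublocale red_scalar: ring_hom_cring R "R Quot I" red_scalar
  by (rule I.rcos_ring_hom_cring[OF R.is_cring])

lemmas red_vector_closed = red_module_carrierI[OF module_axioms ideal]
  and red_vectorE = red_module_carrierE[OF module_axioms ideal]
  and red_scalarE = quot_carrierE[OF module_axioms ideal]
  and red_form_red_vector = red_form_coset[OF module_axioms ideal form involution star_I]
  and red_star_red_scalar = red_star_coset[OF module_axioms ideal involution star_I]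
  and red_vector_add = red_module_add[OF module_axioms ideal]
  and red_vector_smult = red_module_smult[OF module_axioms ideal]
  and red_map_red_vector = red_map_coset[OF module_axioms ideal]

lemma red_scalar_eq_zero_iff:
  assumes a: "a \<in> carrier R"
  shows "red_scalar a = \<zero>\<^bsub>R Quot I\<^esub> \<longleftrightarrow> a \<in> I"
proof -
  show ?thesis
    unfolding zero_FactRing using I.a_rcos_self[OF a] I.a_rcos_const[of a] by blast
qed

lemma red_scalar_unit:
  assumes "a \<in> Units R"
  shows "red_scalar a \<in> Units (R Quot I)" "red_scalar (inv a) = inv\<^bsub>R Quot I\<^esub> red_scalar a"
proof -
  have ac: "a \<in> carrier R" using assms by (rule R.Units_closed)
  have cl: "red_scalar a \<in> carrier (R Quot I)" "red_scalar (inv a) \<in> carrier (R Quot I)"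
    using assms ac by (simp_all add: red_scalar.hom_closed)
  have *: "red_scalar a \<otimes>\<^bsub>R Quot I\<^esub> red_scalar (inv a) = \<one>\<^bsub>R Quot I\<^esub>"
    "red_scalar (inv a) \<otimes>\<^bsub>R Quot I\<^esub> red_scalar a = \<one>\<^bsub>R Quot I\<^esub>"
    using red_scalar.hom_mult[of a "inv a"] red_scalar.hom_mult[of "inv a" a] assms ac
    by simp_all
  show "red_scalar a \<in> Units (R Quot I)"
    using * cl unfolding Units_def by blast
  show "red_scalar (inv a) = inv\<^bsub>R Quot I\<^esub> red_scalar a"
    by (rule red.R.inv_char[symmetric, OF _ _ *]) (rule cl)+
qed

lemma red_map_extensional: "red_map M I g \<in> extensional (carrier (red_module M I))"
  by (simp add: red_map_def)

lemma red_map_unitary: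
  assumes g: "g \<in> carrier U"
  shows "red_map M I g \<in> carrier red.U"
proof -
  interpret U: group U by (rule unitary_group_is_group)
  have g': "inv\<^bsub>U\<^esub> g \<in> carrier U" using g by simp
  have inv: "(inv\<^bsub>U\<^esub> g) (g x) = x" "g ((inv\<^bsub>U\<^esub> g) x) = x" if "x \<in> carrier M" for x
    using that g g' by (simp_all add: unitary_one flip: unitary_mult_apply)
  note reds = red_map_red_vector[OF g] red_map_red_vector[OF g'] red_vector_closed red_vector_add
    red_vector_smult red_form_red_vector
  show ?thesis
    by (rule red.unitaryI[where g' = "red_map M I (inv\<^bsub>U\<^esub> g)"])
      (use g g' inv in \<open>auto elim!: red_vectorE red_scalarE
        simp: reds red_map_extensional unitary_add unitary_smult unitary_h\<close>)
qed

lemma red_map_hom: "red_map M I \<in> hom U red.U"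
proof (rule homI)
  fix g k assume g: "g \<in> carrier U" and k: "k \<in> carrier U"
  interpret U: group U by (rule unitary_group_is_group)
  have gk: "g \<otimes>\<^bsub>U\<^esub> k \<in> carrier U" using g k by simp
  show "red_map M I (g \<otimes>\<^bsub>U\<^esub> k) = red_map M I g \<otimes>\<^bsub>red.U\<^esub> red_map M I k"
  proof (rule extensionalityI)
    show "red_map M I g \<otimes>\<^bsub>red.U\<^esub> red_map M I k \<in> extensional (carrier (red_module M I))"
      using red_map_unitary g k by (simp add: red.unitary_mult)
    fix X assume "X \<in> carrier (red_module M I)"
    then obtain x where x: "x \<in> carrier M" "X = red_vector x" by (rule red_vectorE)
    show "red_map M I (g \<otimes>\<^bsub>U\<^esub> k) X = (red_map M I g \<otimes>\<^bsub>red.U\<^esub> red_map M I k) X"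
      using g k x red_map_unitary red_map_red_vector[OF gk]
      by (simp add: red_map_red_vector red.unitary_mult_apply red_vector_closed unitary_mult_apply)
  qed (rule red_map_extensional)
qed (rule red_map_unitary)

lemma red_map_quasi_reflection:
  assumes w: "w \<in> carrier M" and a: "a \<in> carrier R" and cond: "a = star a \<oplus> star a \<otimes> a \<otimes> h w w"
  shows "red_map M I (quasi_reflection R M h w a)
    = quasi_reflection (R Quot I) (red_module M I) (red_form R I h) (red_vector w) (red_scalar a)"
proof (rule extensionalityI[OF red_map_extensional])
  fix X assume "X \<in> carrier (red_module M I)"
  then obtain x where x: "x \<in> carrier M" "X = red_vector x" by (rule red_vectorE)
  show "red_map M I (quasi_reflection R M h w a) X
      = quasi_reflection (R Quot I) (red_module M I) (red_form R I h) (red_vector w) (red_scalar a) X"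
    using x w a red_map_red_vector[OF quasi_reflection_unitary[OF assms], of x]
    by (simp add: quasi_reflection_def red_form_red_vector red_vector_add red_vector_smult
        red_vector_closed flip: red_scalar.hom_mult)
qed (simp add: quasi_reflection_def)

text \<open>With \<open>c = 1/b\<close> for any lift \<open>b\<close> of \<open>A\<close>, the error \<open>e = c - c* + h(w, w)\<close> lies in \<open>I\<close> and is skew.
  Passing from \<open>c\<close> to \<open>c - e/2\<close> changes \<open>c - c*\<close> by \<open>-e\<close>, so the equation then holds exactly.\<close>

lemma lift_reflection_scalar:
  assumes two: "\<one> \<oplus> \<one> \<in> Units R"
    and units_lift: "\<And>a. a \<in> carrier R \<Longrightarrow> red_scalar a \<in> Units (R Quot I) \<Longrightarrow> a \<in> Units R"
    and w: "w \<in> carrier M" and A: "A \<in> Units (R Quot I)"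
    and cond: "A = red_star R I star A \<oplus>\<^bsub>R Quot I\<^esub> red_star R I star A \<otimes>\<^bsub>R Quot I\<^esub> A \<otimes>\<^bsub>R Quot I\<^esub>
      red_form R I h (red_vector w) (red_vector w)"
  shows "\<exists>a\<in>Units R. red_scalar a = A \<and> a = star a \<oplus> star a \<otimes> a \<otimes> h w w"
proof -
  define q where "q = h w w"
  have q: "q \<in> carrier R" "star q = \<ominus> q" using w by (auto simp: q_def star_h)
  obtain b where b: "b \<in> carrier R" "A = red_scalar b"
    using red.R.Units_closed[OF A] by (rule red_scalarE)
  then have b_unit: "b \<in> Units R" using A units_lift by blast
  have sb: "star b \<in> Units R" "star b \<in> carrier R" using star_Units[OF b_unit] b by auto
  define c where "c = inv b"
  have c: "c \<in> Units R" "c \<in> carrier R" "star c \<in> carrier R" "b \<otimes> c = \<one>" "star b \<otimes> star c = \<one>"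
    using b_unit sb by (auto simp: c_def star_inv)
  define e where "e = c \<oplus> \<ominus> star c \<oplus> q"
  have e: "e \<in> carrier R" using c q by (simp add: e_def)
  have "star e = \<ominus> e" using c q by (simp add: e_def R.minus_add R.a_ac)
  have "e \<in> I"
  proof -
    define f where "f = star b \<oplus> star b \<otimes> b \<otimes> q"
    have f: "f \<in> carrier R" using b sb q by (simp add: f_def)
    have "red_scalar f = red_scalar b"
      using cond b sb q w
      by (simp add: f_def red_star_red_scalar red_form_red_vector flip: q_def)
    then have "red_scalar (f \<oplus> \<ominus> b) = \<zero>\<^bsub>R Quot I\<^esub>" using b f by (simp add: red.R.r_neg)
    then have fI: "f \<oplus> \<ominus> b \<in> I" using red_scalar_eq_zero_iff[of "f \<oplus> \<ominus> b"] b f by blast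
    \<comment> \<open>Dividing the equation for \<open>b\<close> by \<open>b* b\<close> turns its defect into \<open>e\<close>.\<close>
    have "c \<otimes> star c \<otimes> (f \<oplus> \<ominus> b)
        = (star b \<otimes> star c) \<otimes> c \<oplus> (star b \<otimes> star c) \<otimes> (b \<otimes> c) \<otimes> q \<oplus> \<ominus> ((b \<otimes> c) \<otimes> star c)"
      unfolding f_def using b(1) c(2,3) sb(2) q(1) by algebra
    also have "\<dots> = e" using c q by (simp add: e_def R.a_ac)
    finally show ?thesis using I.I_l_closed[OF fI, of "c \<otimes> star c"] c by simp
  qed
  define t where "t = inv (\<one> \<oplus> \<one>) \<otimes> e"
  have half: "inv (\<one> \<oplus> \<one>) \<in> carrier R" using two by simp
  have t: "t \<in> carrier R" "t \<in> I" using half e \<open>e \<in> I\<close> I.I_l_closed by (auto simp: t_def)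
  have "star (inv (\<one> \<oplus> \<one>)) = inv (\<one> \<oplus> \<one>)" using two by (simp add: star_inv)
  then have star_t: "star t = \<ominus> t" using half e \<open>star e = \<ominus> e\<close> by (simp add: t_def R.r_minus)
  have "t \<oplus> t = (\<one> \<oplus> \<one>) \<otimes> inv (\<one> \<oplus> \<one>) \<otimes> e"
    unfolding t_def using half e by algebra
  then have tt: "t \<oplus> t = e" using two e by simp
  define d where "d = c \<oplus> \<ominus> t"
  have d: "d \<in> carrier R" using c t by (simp add: d_def)
  have red_t: "red_scalar t = \<zero>\<^bsub>R Quot I\<^esub>" using red_scalar_eq_zero_iff t by simp
  have red_d: "red_scalar d = red_scalar c" using c t by (simp add: d_def red_t)
  then have d_unit: "d \<in> Units R" using units_lift d red_scalar_unit(1)[OF c(1)] by simp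
  have star_d: "star d = d \<oplus> q"
  proof -
    have "star d = star c \<oplus> t" using c t star_t by (simp add: d_def)
    also have "\<dots> = star c \<oplus> (t \<oplus> t) \<oplus> \<ominus> t" using c(3) t(1) by algebra
    also have "\<dots> = d \<oplus> q" unfolding tt e_def d_def using c(2,3) t(1) q(1) by algebra
    finally show ?thesis .
  qed
  define a where "a = inv d"
  have a: "a \<in> Units R" "a \<in> carrier R" "star a \<in> carrier R" "a \<otimes> d = \<one>" "star a \<otimes> star d = \<one>"
    using d_unit star_Units[OF d_unit] by (auto simp: a_def star_inv)
  have "star a \<oplus> star a \<otimes> a \<otimes> q = star a \<otimes> (a \<otimes> d) \<oplus> star a \<otimes> a \<otimes> q" using a by simp
  also have "\<dots> = star a \<otimes> (d \<oplus> q) \<otimes> a" using a(2,3) d q(1) by algebra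
  also have "\<dots> = a" using a by (simp flip: star_d)
  finally have "a = star a \<oplus> star a \<otimes> a \<otimes> h w w" by (simp add: q_def)
  moreover have "red_scalar a = A"
  proof -
    have "red_scalar a = inv\<^bsub>R Quot I\<^esub> red_scalar c"
      using red_scalar_unit(2)[OF d_unit] by (simp add: a_def red_d)
    also have "\<dots> = red_scalar (inv c)" using red_scalar_unit(2)[OF c(1)] by simp
    finally show ?thesis using b b_unit by (simp add: c_def)
  qed
  ultimately show ?thesis using a(1) by blast
qed

lemma lift_quasi_reflection:
  assumes two: "\<one> \<oplus> \<one> \<in> Units R"
    and units_lift: "\<And>a. a \<in> carrier R \<Longrightarrow> red_scalar a \<in> Units (R Quot I) \<Longrightarrow> a \<in> Units R"
    and \<rho>: "\<rho> \<in> quasi_reflections (R Quot I) (red_star R I star) (red_module M I) (red_form R I h)"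
  shows "\<rho> \<in> red_map M I ` carrier U"
proof -
  obtain W A where W: "W \<in> carrier (red_module M I)" and A: "A \<in> Units (R Quot I)"
    and cond: "A = red_star R I star A \<oplus>\<^bsub>R Quot I\<^esub> red_star R I star A \<otimes>\<^bsub>R Quot I\<^esub> A \<otimes>\<^bsub>R Quot I\<^esub> red_form R I h W W"
    and \<rho>_eq: "\<rho> = quasi_reflection (R Quot I) (red_module M I) (red_form R I h) W A"
    using \<rho> unfolding quasi_reflections_def by blast
  obtain w where w: "w \<in> carrier M" "W = red_vector w" using W by (rule red_vectorE)
  obtain a where a: "a \<in> Units R" "red_scalar a = A" "a = star a \<oplus> star a \<otimes> a \<otimes> h w w"
    using lift_reflection_scalar[OF two units_lift w(1) A] cond w(2) by blast
  note a' = w(1) R.Units_closed[OF a(1)] a(3)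
  show ?thesis
    using red_map_quasi_reflection[OF a'] quasi_reflection_unitary[OF a'] w a \<rho>_eq by (metis imageI)
qed

text \<open>A submodule of \<open>M/IM\<close> that contains the reduced basis has a preimage that contains the basis of \<open>M\<close>,
  so this is how the reduced basis inherits the spanning property.\<close>

lemma submodule_preimage:
  assumes N: "submodule N (R Quot I) (red_module M I)"
  shows "submodule {x \<in> carrier M. red_vector x \<in> N} R M" (is "submodule ?P R M")
proof -
  have smult: "a \<odot>\<^bsub>M\<^esub> x \<in> ?P" if "a \<in> carrier R" "x \<in> ?P" for a x
    using that red.submoduleE(4)[OF N, of "red_scalar a" "red_vector x"]
    by (simp add: red_vector_smult)
  obtain X where "X \<in> N" using red.submoduleE(2)[OF N] by blast
  moreover from this obtain x where "x \<in> carrier M" "X = red_vector x"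
    using red.submoduleE(1)[OF N] by (blast elim: red_vectorE)
  ultimately have x: "x \<in> ?P" by simp
  show ?thesis
  proof (rule submoduleI)
    show "\<zero>\<^bsub>M\<^esub> \<in> ?P" using smult[OF R.zero_closed x] x by simp
    show "\<ominus>\<^bsub>M\<^esub> y \<in> ?P" if "y \<in> ?P" for y
      using smult[of "\<ominus> \<one>" y] that by (simp add: smult_l_minus)
    show "y \<oplus>\<^bsub>M\<^esub> z \<in> ?P" if "y \<in> ?P" "z \<in> ?P" for y z
      using that red.submoduleE(5)[OF N, of "red_vector y" "red_vector z"]
      by (simp add: red_vector_add)
  qed (use smult in auto)
qed

end

section \<open>Surjectivity of the reduction\<close>

theorem theorem10p7:
  fixes S :: "('a, 'm) ring_scheme" and V :: "('a, 'b, 'n) module_scheme"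
    and star :: "'a \<Rightarrow> 'a" and h :: "'b \<Rightarrow> 'b \<Rightarrow> 'a" and I :: "'a set" and m :: nat
  assumes "local_cring S"
    and "ring_involution S star"
    and "m \<ge> 1"
    and "free_module_of_rank S V (2 * m)"
    and "skew_hermitian_form S star V h"
    and "nondegenerate_form S V h"
    and "\<exists>u v. symplectic_basis S V h m u v"
    and "ideal I S" and "I \<noteq> carrier S" and "star ` I \<subseteq> I"
    and "\<one>\<^bsub>S\<^esub> \<oplus>\<^bsub>S\<^esub> \<one>\<^bsub>S\<^esub> \<in> Units S"
  shows "red_map V I \<in>
    epi (unitary_group S V h) (unitary_group (S Quot I) (red_module V I) (red_form S I h))"
proof -
  interpret S: local_cring S by fact
  interpret form_reduction S V star h I
    using assms
    by (simp add: form_reduction_def form_reduction_axioms_def skew_hermitian_module_def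
        skew_hermitian_module_axioms_def free_module_of_rank_def)
  have units_lift: "a \<in> Units S" if "a \<in> carrier S" "red_scalar a \<in> Units (S Quot I)" for a
    using S.unit_mod_ideal_imp_unit assms that by blast
  obtain u v where uv: "symplectic_basis S V h m u v" using assms by blast
  then have basis: "module_basis S V ({..<m} <+> {..<m}) (case_sum u v)"
    by (simp add: symplectic_basis_def)
  have uv_closed: "u i \<in> carrier V \<and> v i \<in> carrier V" if "i < m" for i
  proof -
    have e: "case_sum u v \<in> ({..<m} <+> {..<m}) \<rightarrow> carrier V"
      using basis by (simp add: module_basis_def)
    show ?thesis
      using that funcset_mem[OF e InlI[of i]] funcset_mem[OF e InrI[of i]] by simp
  qed
  interpret red_local: local_symplectic_module "S Quot I" "red_module V I" "red_star S I star"
    "red_form S I h" m "\<lambda>i. red_vector (u i)" "\<lambda>i. red_vector (v i)"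
  proof unfold_locales
    fix A B assume "A \<in> carrier (S Quot I)" "B \<in> carrier (S Quot I)"
      and AB: "A \<oplus>\<^bsub>S Quot I\<^esub> B \<in> Units (S Quot I)"
    then obtain a b where ab: "a \<in> carrier S" "A = red_scalar a" "b \<in> carrier S" "B = red_scalar b"
      by (elim red_scalarE)
    then have "a \<oplus>\<^bsub>S\<^esub> b \<in> Units S" using AB units_lift by simp
    then show "A \<in> Units (S Quot I) \<or> B \<in> Units (S Quot I)"
      using S.sum_unit_imp_unit ab red_scalar_unit(1) by blast
  next
    show "\<zero>\<^bsub>S Quot I\<^esub> \<notin> Units (S Quot I)"
    proof
      assume "\<zero>\<^bsub>S Quot I\<^esub> \<in> Units (S Quot I)"
      then have "\<zero>\<^bsub>S\<^esub> \<in> Units S" using units_lift[of "\<zero>\<^bsub>S\<^esub>"] by simp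
      then show False using I.unit_imp_carrier[of "\<zero>\<^bsub>S\<^esub>"] assms(9) by simp
    qed
  next
    fix N assume N: "submodule N (S Quot I) (red_module V I)"
      and uvN: "\<And>i. i < m \<Longrightarrow> red_vector (u i) \<in> N \<and> red_vector (v i) \<in> N"
    have "carrier V \<subseteq> {x \<in> carrier V. red_vector x \<in> N}"
      by (rule module_basis_spans[OF basis submodule_preimage[OF N]])
        (use uvN uv_closed in auto)
    then show "carrier (red_module V I) \<subseteq> N" by (auto elim!: red_vectorE)
  qed (use uv uv_closed in \<open>auto simp: symplectic_basis_def red_vector_closed red_form_red_vector\<close>)
  interpret red_map: group_hom U red.U "red_map V I"
    using unitary_group_is_group red.unitary_group_is_group red_map_hom
    by (simp add: group_hom_def group_hom_axioms_def)
  have "red_local.G \<subseteq> red_map V I ` carrier U"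
    using lift_quasi_reflection[OF assms(11) units_lift] red_map.img_is_subgroup
    by (intro red_local.U.generate_subgroup_incl) auto
  then show ?thesis
    using red_map_hom red_local.unitary_group_generated_by_quasi_reflections
    by (simp add: epi_iff_subset)
qed

end
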